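(* Let $p$ be a prime and $n\ge 2$ an integer (with $n\ge 3$ if $p=2$) such that $\phi(p^n)\le 66$, and let $\theta$ be a primitive $p^n$-th root of unity. Let $t$ be a positive integer such that $\mathcal{U}(\mathbb{Z}_{p^n})=\langle\bar t\rangle$ if $p$ is odd, and $t=3$ if $p=2$. Let $\mu_t=1+\theta+\theta^2+\cdots+\theta^{t-1}$, a unit of $\mathbb{Z}[\theta]$. Then $$(-1)^p(\mu_t)^{\frac{\phi(p^n)}{2p}}\notin \mathrm{Im}(\overline{\pi}_1).$$
   Context: $\phi$ is Euler's totient; $\mathbb{Z}_m=\mathbb{Z}/m\mathbb{Z}$; $\mathcal{U}(R)$ is the unit group of a ring $R$. Let $C_{p^n}=\langle g\rangle$ be cyclic of order $p^n$ and $\mathcal{U}_1(\mathbb{Z}C_{p^n})$ the group of units of $\mathbb{Z}C_{p^n}$ of augmentation $1$. The map $\overline{\pi}_1:\mathcal{U}_1(\mathbb{Z}C_{p^n})\to\mathcal{U}(\mathbb{Z}[\theta])$ is the restriction of the ring homomorphism $\pi_1:\mathbb{Z}C_{p^n}\to\mathbb{Z}[\theta]$ with $\pi_1(g)=\theta$. *)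

theory Defs
  imports
    "HOL-Algebra.Generated_Groups"
    "HOL-Number_Theory.Residues"
    "HOL-Computational_Algebra.Polynomial"
    Complex_Main
begin

definition group_ring_elem :: "'g \<Rightarrow> 'g \<Rightarrow> int"
  where "group_ring_elem g = (\<lambda>x. if x = g then 1 else 0)"

text \<open>
  The integral group ring of \<open>G\<close>: the formal sum of the \<open>f x \<cdot> x\<close> is represented by its
  coefficient function \<open>f\<close>, which has finite support inside \<open>carrier G\<close>. The product is
  convolution: the coefficient of \<open>x\<close> collects all factorisations \<open>x = y \<otimes> (inv y \<otimes> x)\<close>.
\<close>

definition integral_group_ring :: "('g, 'm) monoid_scheme \<Rightarrow> ('g \<Rightarrow> int) ring"
  where "integral_group_ring G =
    \<lparr>carrier = {f. finite {x. f x \<noteq> 0} \<and> {x. f x \<noteq> 0} \<subseteq> carrier G},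
     monoid.mult = (\<lambda>f h x. if x \<in> carrier G
        then \<Sum>y | f y \<noteq> 0. f y * h (inv\<^bsub>G\<^esub> y \<otimes>\<^bsub>G\<^esub> x) else 0),
     monoid.one = group_ring_elem \<one>\<^bsub>G\<^esub>,
     ring.zero = (\<lambda>x. 0),
     ring.add = (\<lambda>f h x. f x + h x)\<rparr>"

definition augmentation :: "('g \<Rightarrow> int) \<Rightarrow> int"
  where "augmentation f = (\<Sum>x | f x \<noteq> 0. f x)"

definition units_of_augmentation_one :: "('g, 'm) monoid_scheme \<Rightarrow> ('g \<Rightarrow> int) set"
  where "units_of_augmentation_one G =
    {u \<in> Units (integral_group_ring G). augmentation u = 1}"

definition int_adjoin :: "complex \<Rightarrow> complex ring"
  where "int_adjoin \<theta> =
    \<lparr>carrier = range (\<lambda>q :: int poly. poly (map_poly of_int q) \<theta>),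
     monoid.mult = (*), monoid.one = 1, ring.zero = 0, ring.add = (+)\<rparr>"

lemma (in group) group_ring_mult_eq:
  assumes "finite A" "{y. f y \<noteq> 0} \<subseteq> A" "x \<in> carrier G"
  shows "(f \<otimes>\<^bsub>integral_group_ring G\<^esub> h) x = (\<Sum>y\<in>A. f y * h (inv y \<otimes> x))"
proof -
  have "(f \<otimes>\<^bsub>integral_group_ring G\<^esub> h) x = (\<Sum>y | f y \<noteq> 0. f y * h (inv y \<otimes> x))"
    using assms by (simp add: integral_group_ring_def)
  also have "\<dots> = (\<Sum>y\<in>A. f y * h (inv y \<otimes> x))"
    using assms by (intro sum.mono_neutral_left) auto
  finally show ?thesis .
qed

lemma (in group) group_ring_mult_support:
  assumes "{y. f y \<noteq> 0} \<subseteq> carrier G"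
  shows "{x. (f \<otimes>\<^bsub>integral_group_ring G\<^esub> h) x \<noteq> 0} \<subseteq>
    (\<lambda>(y, w). y \<otimes> w) ` ({y. f y \<noteq> 0} \<times> {w. h w \<noteq> 0})"
proof
  fix x assume x: "x \<in> {x. (f \<otimes>\<^bsub>integral_group_ring G\<^esub> h) x \<noteq> 0}"
  then have xG: "x \<in> carrier G"
    by (auto simp: integral_group_ring_def split: if_splits)
  from x xG have "(\<Sum>y | f y \<noteq> 0. f y * h (inv y \<otimes> x)) \<noteq> 0"
    by (simp add: integral_group_ring_def)
  then obtain y where y: "f y \<noteq> 0" "h (inv y \<otimes> x) \<noteq> 0"
    by (auto elim!: sum.not_neutral_contains_not_neutral)
  moreover have "x = y \<otimes> (inv y \<otimes> x)"
    using y xG assms by (subst m_assoc [symmetric]) auto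
  ultimately show "x \<in> (\<lambda>(y, w). y \<otimes> w) ` ({y. f y \<noteq> 0} \<times> {w. h w \<noteq> 0})"
    by (intro image_eqI [where x = "(y, inv y \<otimes> x)"]) auto
qed

lemma (in group) group_ring_mult_closed:
  assumes "f \<in> carrier (integral_group_ring G)" "h \<in> carrier (integral_group_ring G)"
  shows "f \<otimes>\<^bsub>integral_group_ring G\<^esub> h \<in> carrier (integral_group_ring G)"
proof -
  have *: "finite {x. f x \<noteq> 0}" "{x. f x \<noteq> 0} \<subseteq> carrier G" "finite {x. h x \<noteq> 0}"
    using assms by (auto simp: integral_group_ring_def)
  have "finite {x. (f \<otimes>\<^bsub>integral_group_ring G\<^esub> h) x \<noteq> 0}"
    by (rule finite_subset [OF group_ring_mult_support]) (use * in auto)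
  moreover have "{x. (f \<otimes>\<^bsub>integral_group_ring G\<^esub> h) x \<noteq> 0} \<subseteq> carrier G"
    by (auto simp: integral_group_ring_def split: if_splits)
  ultimately show ?thesis
    by (simp add: integral_group_ring_def)
qed

lemma (in group) group_ring_mult_assoc:
  assumes f: "f \<in> carrier (integral_group_ring G)"
    and h: "h \<in> carrier (integral_group_ring G)"
  shows "(f \<otimes>\<^bsub>integral_group_ring G\<^esub> h) \<otimes>\<^bsub>integral_group_ring G\<^esub> k =
    f \<otimes>\<^bsub>integral_group_ring G\<^esub> (h \<otimes>\<^bsub>integral_group_ring G\<^esub> k)" (is "?L = ?R")
proof
  fix x
  show "?L x = ?R x"
  proof (cases "x \<in> carrier G")
    case x: True
    define A where "A = {y. f y \<noteq> 0}"
    define B where "B = {y. h y \<noteq> 0}"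
    define C where "C = (\<lambda>(y, w). y \<otimes> w) ` (A \<times> B)"
    have fin: "finite A" "finite B" "finite C" and sub: "A \<subseteq> carrier G" "B \<subseteq> carrier G"
      using f h by (auto simp: integral_group_ring_def A_def B_def C_def)
    have subC: "C \<subseteq> carrier G"
      using sub by (auto simp: C_def)
    have "?L x = (\<Sum>z\<in>C. (f \<otimes>\<^bsub>integral_group_ring G\<^esub> h) z * k (inv z \<otimes> x))"
      using fin x sub group_ring_mult_support [of f h]
      by (intro group_ring_mult_eq) (auto simp: A_def B_def C_def)
    also have "\<dots> = (\<Sum>z\<in>C. (\<Sum>y\<in>A. f y * h (inv y \<otimes> z)) * k (inv z \<otimes> x))"
      using fin subC
      by (intro sum.cong refl arg_cong2 [where f = "(*)"] group_ring_mult_eq) (auto simp: A_def)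
    also have "\<dots> = (\<Sum>y\<in>A. f y * (\<Sum>z\<in>C. h (inv y \<otimes> z) * k (inv z \<otimes> x)))"
      by (simp add: sum_distrib_left sum_distrib_right mult.assoc) (rule sum.swap)
    also have "\<dots> = (\<Sum>y\<in>A. f y * (\<Sum>w\<in>B. h w * k (inv w \<otimes> (inv y \<otimes> x))))"
    proof (rule sum.cong [OF refl])
      fix y assume y: "y \<in> A"
      then have yG: "y \<in> carrier G" using sub by auto
      have inj: "inj_on (\<lambda>w. y \<otimes> w) B"
        using inj_on_cmult [OF yG] sub(2) by (rule inj_on_subset)
      have im: "(\<lambda>w. y \<otimes> w) ` B \<subseteq> C"
        using y by (auto simp: C_def)
      have "(\<Sum>z\<in>C. h (inv y \<otimes> z) * k (inv z \<otimes> x)) =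
          (\<Sum>z\<in>(\<lambda>w. y \<otimes> w) ` B. h (inv y \<otimes> z) * k (inv z \<otimes> x))"
      proof (intro sum.mono_neutral_right fin im ballI)
        fix z assume z: "z \<in> C - (\<lambda>w. y \<otimes> w) ` B"
        have "z = y \<otimes> (inv y \<otimes> z)"
          using z subC yG by (subst m_assoc [symmetric]) auto
        then have "inv y \<otimes> z \<notin> B" using z by auto
        then show "h (inv y \<otimes> z) * k (inv z \<otimes> x) = 0" by (simp add: B_def)
      qed
      also have "\<dots> = (\<Sum>w\<in>B. h (inv y \<otimes> (y \<otimes> w)) * k (inv (y \<otimes> w) \<otimes> x))"
        by (subst sum.reindex [OF inj]) simp
      also have "\<dots> = (\<Sum>w\<in>B. h w * k (inv w \<otimes> (inv y \<otimes> x)))"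
      proof (intro sum.cong refl)
        fix w assume "w \<in> B"
        then have w: "w \<in> carrier G" using sub by auto
        have "inv y \<otimes> (y \<otimes> w) = w"
          using w yG by (subst m_assoc [symmetric]) auto
        moreover have "inv (y \<otimes> w) \<otimes> x = inv w \<otimes> (inv y \<otimes> x)"
          using w yG x by (simp add: inv_mult_group m_assoc)
        ultimately show "h (inv y \<otimes> (y \<otimes> w)) * k (inv (y \<otimes> w) \<otimes> x) =
            h w * k (inv w \<otimes> (inv y \<otimes> x))" by simp
      qed
      finally show "f y * (\<Sum>z\<in>C. h (inv y \<otimes> z) * k (inv z \<otimes> x)) =
          f y * (\<Sum>w\<in>B. h w * k (inv w \<otimes> (inv y \<otimes> x)))" by simp
    qed
    also have "\<dots> = (\<Sum>y\<in>A. f y * (h \<otimes>\<^bsub>integral_group_ring G\<^esub> k) (inv y \<otimes> x))"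
      using fin sub x
      by (intro sum.cong refl arg_cong2 [where f = "(*)"] group_ring_mult_eq [symmetric])
        (auto simp: B_def)
    also have "\<dots> = ?R x"
      using fin x by (intro group_ring_mult_eq [symmetric]) (auto simp: A_def)
    finally show ?thesis .
  qed (simp add: integral_group_ring_def)
qed

lemma (in group) ring_integral_group_ring: "ring (integral_group_ring G)"
proof (rule ringI)
  show "abelian_group (integral_group_ring G)"
  proof (rule abelian_groupI)
    fix f h assume "f \<in> carrier (integral_group_ring G)" "h \<in> carrier (integral_group_ring G)"
    then have *: "finite {x. f x \<noteq> 0}" "{x. f x \<noteq> 0} \<subseteq> carrier G"
        "finite {x. h x \<noteq> 0}" "{x. h x \<noteq> 0} \<subseteq> carrier G"
      by (auto simp: integral_group_ring_def)
    have "{x. f x + h x \<noteq> 0} \<subseteq> {x. f x \<noteq> 0} \<union> {x. h x \<noteq> 0}" by auto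
    then have "finite {x. f x + h x \<noteq> 0}" "{x. f x + h x \<noteq> 0} \<subseteq> carrier G"
      using * by (blast intro: finite_subset)+
    then show "f \<oplus>\<^bsub>integral_group_ring G\<^esub> h \<in> carrier (integral_group_ring G)"
      by (simp add: integral_group_ring_def)
  next
    fix f assume f: "f \<in> carrier (integral_group_ring G)"
    show "\<exists>h\<in>carrier (integral_group_ring G).
        h \<oplus>\<^bsub>integral_group_ring G\<^esub> f = \<zero>\<^bsub>integral_group_ring G\<^esub>"
      by (rule bexI [where x = "\<lambda>x. - f x"]) (use f in \<open>auto simp: integral_group_ring_def\<close>)
  qed (auto simp: integral_group_ring_def add.assoc add.commute)
next
  show "monoid (integral_group_ring G)"
  proof (rule monoidI)
    show one: "\<one>\<^bsub>integral_group_ring G\<^esub> \<in> carrier (integral_group_ring G)"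
      by (auto simp: integral_group_ring_def group_ring_elem_def)
    fix f assume f: "f \<in> carrier (integral_group_ring G)"
    then have fin: "finite {x. f x \<noteq> 0}" "{x. f x \<noteq> 0} \<subseteq> carrier G"
      by (auto simp: integral_group_ring_def)
    show "\<one>\<^bsub>integral_group_ring G\<^esub> \<otimes>\<^bsub>integral_group_ring G\<^esub> f = f"
      using fin by (auto simp: integral_group_ring_def group_ring_elem_def fun_eq_iff)
    show "f \<otimes>\<^bsub>integral_group_ring G\<^esub> \<one>\<^bsub>integral_group_ring G\<^esub> = f"
    proof
      fix x
      show "(f \<otimes>\<^bsub>integral_group_ring G\<^esub> \<one>\<^bsub>integral_group_ring G\<^esub>) x = f x"
      proof (cases "x \<in> carrier G")
        case x: True
        have "(f \<otimes>\<^bsub>integral_group_ring G\<^esub> \<one>\<^bsub>integral_group_ring G\<^esub>) x =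
            (\<Sum>y | f y \<noteq> 0. f y * (if inv y \<otimes> x = \<one> then 1 else 0))"
          using x by (simp add: integral_group_ring_def group_ring_elem_def)
        also have "\<dots> = (\<Sum>y | f y \<noteq> 0. if y = x then f y else 0)"
        proof (intro sum.cong refl)
          fix y assume "y \<in> {y. f y \<noteq> 0}"
          then have y: "y \<in> carrier G" using fin by auto
          have "inv y \<otimes> x = \<one> \<longleftrightarrow> y = x"
            using x y by (metis inv_closed inv_equality inv_inv l_inv)
          then show "f y * (if inv y \<otimes> x = \<one> then 1 else 0) = (if y = x then f y else 0)"
            by simp
        qed
        also have "\<dots> = f x" using fin by simp
        finally show ?thesis .
      qed (use fin in \<open>auto simp: integral_group_ring_def\<close>)
    qed
  qed (auto intro: group_ring_mult_closed group_ring_mult_assoc)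
next
  fix f h k
  assume f: "f \<in> carrier (integral_group_ring G)" and h: "h \<in> carrier (integral_group_ring G)"
    and k: "k \<in> carrier (integral_group_ring G)"
  show "(f \<oplus>\<^bsub>integral_group_ring G\<^esub> h) \<otimes>\<^bsub>integral_group_ring G\<^esub> k =
      (f \<otimes>\<^bsub>integral_group_ring G\<^esub> k) \<oplus>\<^bsub>integral_group_ring G\<^esub> (h \<otimes>\<^bsub>integral_group_ring G\<^esub> k)"
    (is "?L = ?R")
  proof
    fix x
    show "?L x = ?R x"
    proof (cases "x \<in> carrier G")
      case x: True
      define A where "A = {x. f x \<noteq> 0} \<union> {x. h x \<noteq> 0}"
      have A: "finite A" "{x. f x \<noteq> 0} \<subseteq> A" "{x. h x \<noteq> 0} \<subseteq> A"
          "{x. (f \<oplus>\<^bsub>integral_group_ring G\<^esub> h) x \<noteq> 0} \<subseteq> A"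
        using f h by (auto simp: integral_group_ring_def A_def)
      have add: "(u \<oplus>\<^bsub>integral_group_ring G\<^esub> v) z = u z + v z" for u v :: "'a \<Rightarrow> int" and z
        by (simp add: integral_group_ring_def)
      have "?L x = (\<Sum>y\<in>A. (f \<oplus>\<^bsub>integral_group_ring G\<^esub> h) y * k (inv y \<otimes> x))"
        using A x by (intro group_ring_mult_eq)
      moreover have "(f \<otimes>\<^bsub>integral_group_ring G\<^esub> k) x = (\<Sum>y\<in>A. f y * k (inv y \<otimes> x))"
        using A x by (intro group_ring_mult_eq)
      moreover have "(h \<otimes>\<^bsub>integral_group_ring G\<^esub> k) x = (\<Sum>y\<in>A. h y * k (inv y \<otimes> x))"
        using A x by (intro group_ring_mult_eq)
      ultimately show ?thesis
        by (simp add: add sum.distrib algebra_simps)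
    qed (simp add: integral_group_ring_def)
  qed
  show "k \<otimes>\<^bsub>integral_group_ring G\<^esub> (f \<oplus>\<^bsub>integral_group_ring G\<^esub> h) =
      (k \<otimes>\<^bsub>integral_group_ring G\<^esub> f) \<oplus>\<^bsub>integral_group_ring G\<^esub> (k \<otimes>\<^bsub>integral_group_ring G\<^esub> h)"
    by (auto simp: integral_group_ring_def fun_eq_iff sum.distrib algebra_simps)
qed

end

theory Submission
  imports Defs "HOL-Computational_Algebra.Polynomial_FPS"
begin

text \<open>
  Write \<open>q = p ^ (n - 1)\<close> and identify \<open>\<int>C\<close>, with \<open>C\<close> cyclic of order \<open>p ^ n\<close>, with
  \<open>\<int>[x]/(x^(p^n) - 1)\<close>. The obstruction is the determinant of multiplication on the quotient
  \<open>\<int>[x]/(x\<^sup>q - 1)\<close>, that is, \<open>D(f) = \<Prod>w. f(w)\<close> over all complex \<open>w\<close> with \<open>w\<^sup>q = 1\<close>. It is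
  multiplicative and integer-valued, so it is \<open>\<plusminus>1\<close> on units.

  Suppose that a unit \<open>u\<close> of \<open>\<int>C\<close> maps to \<open>F(\<theta>)\<close> with \<open>F = \<plusminus>(1 + x + \<dots> + x^(t-1)) ^ e\<close>. Then
  \<open>u - F\<close> is a multiple of the cyclotomic polynomial of index \<open>p ^ n\<close>, whose value at every \<open>w\<close> with
  \<open>w\<^sup>q = 1\<close> is \<open>p\<close>; so \<open>F\<close> times the inverse of \<open>u\<close> has the form \<open>1 + p h\<close> in \<open>\<int>[x]/(x\<^sup>q - 1)\<close>. The crucial point is that
  \<open>D\<close> improves this congruence: \<open>D(1 + p h)\<close> is \<open>1\<close> not only modulo \<open>p\<close> but modulo
  \<open>p q = p ^ n\<close> (lemma \<open>prod_roots_of_unity_cong_1\<close>), because all power sums of the values \<open>h(w)\<close>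
  are divisible by \<open>q\<close>. Since \<open>D(F) = \<plusminus>t ^ e\<close> for \<open>t\<close> prime to \<open>p\<close>, it
  follows that \<open>t ^ e\<close> is \<open>\<plusminus>1\<close> modulo \<open>p ^ n\<close>
  (theorem \<open>geometric_sum_power_in_image_imp_cong\<close>).

  For \<open>e = totient (p ^ n) div (2 * p)\<close> this is impossible. If \<open>p\<close> is odd, then \<open>t\<close> would have order
  dividing \<open>2 * e = totient (p ^ n) div p\<close>, although it generates the units modulo \<open>p ^ n\<close>. If
  \<open>p = 2\<close>, then \<open>e = 2 ^ (n - 3)\<close>, and \<open>3 ^ e\<close> is \<open>3\<close> modulo \<open>8\<close> for \<open>n = 3\<close> and
  \<open>1 + 2 ^ (n - 1)\<close> modulo \<open>2 ^ n\<close> for \<open>n \<ge> 4\<close>, never \<open>\<plusminus>1\<close>.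

  Two facts of algebraic number theory enter. The rational numbers in \<open>\<int>[z]\<close>, for a root of unity
  \<open>z\<close>, are integers (\<open>rat_in_Zadj_root_of_unity\<close>). An integer polynomial that vanishes at a root of
  unity of exact order \<open>p ^ n\<close> is divisible by the cyclotomic polynomial
  (\<open>cyclo_dvd_if_vanishing\<close>).
\<close>

section \<open>Integer polynomials at roots of unity\<close>

abbreviation ipoly :: "int poly \<Rightarrow> complex \<Rightarrow> complex"
  where "ipoly P z \<equiv> poly (map_poly of_int P) z"

lemma ipoly_pCons [simp]: "ipoly (pCons a P) z = of_int a + z * ipoly P z"
  by (simp add: map_poly_pCons)

lemma ipoly_add [simp]: "ipoly (P + Q) z = ipoly P z + ipoly Q z"
  by (induction P Q rule: poly_induct2) (simp_all add: algebra_simps)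

lemma ipoly_smult [simp]: "ipoly (smult c P) z = of_int c * ipoly P z"
  by (induction P) (simp_all add: algebra_simps)

lemma ipoly_uminus [simp]: "ipoly (- P) z = - ipoly P z"
  using ipoly_smult [of "-1" P z] by simp

lemma ipoly_diff [simp]: "ipoly (P - Q) z = ipoly P z - ipoly Q z"
  using ipoly_add [of P "- Q" z] by simp

lemma ipoly_mult [simp]: "ipoly (P * Q) z = ipoly P z * ipoly Q z"
  by (induction P) (simp_all add: algebra_simps)

lemma ipoly_power [simp]: "ipoly (P ^ k) z = ipoly P z ^ k"
  by (induction k) simp_all

lemma ipoly_monom [simp]: "ipoly (monom c k) z = of_int c * z ^ k"
  by (simp add: map_poly_monom poly_monom)

lemma ipoly_sum [simp]: "ipoly (\<Sum>i\<in>A. f i) z = (\<Sum>i\<in>A. ipoly (f i) z)"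
  by (induction A rule: infinite_finite_induct) simp_all

lemma ipoly_altdef: "ipoly P z = (\<Sum>i\<le>degree P. of_int (coeff P i) * z ^ i)"
  by (simp add: poly_altdef coeff_map_poly degree_map_poly)

lemma ipoly_pcompose [simp]: "ipoly (pcompose P Q) z = ipoly P (ipoly Q z)"
  by (induction P) (simp_all add: pcompose_pCons)

abbreviation Zadj :: "complex \<Rightarrow> complex set"
  where "Zadj z \<equiv> carrier (int_adjoin z)"

lemma Zadj_def: "Zadj z = range (\<lambda>P. ipoly P z)"
  by (simp add: int_adjoin_def)

lemma Zadj_ipoly [intro]: "ipoly P z \<in> Zadj z"
  by (auto simp: Zadj_def)

lemma Zadj_int [intro, simp]: "of_int c \<in> Zadj z"
  using Zadj_ipoly [of "[:c:]" z] by simp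

lemma Zadj_0 [intro, simp]: "0 \<in> Zadj z" and Zadj_1 [intro, simp]: "1 \<in> Zadj z"
  using Zadj_int [of 0 z] Zadj_int [of 1 z] by simp_all

lemma Zadj_self [intro, simp]: "z \<in> Zadj z"
  using Zadj_ipoly [of "[:0, 1:]" z] by simp

lemma Zadj_add [intro]: "a \<in> Zadj z \<Longrightarrow> b \<in> Zadj z \<Longrightarrow> a + b \<in> Zadj z"
  unfolding Zadj_def by (auto simp flip: ipoly_add)

lemma Zadj_uminus [intro]: "a \<in> Zadj z \<Longrightarrow> - a \<in> Zadj z"
  unfolding Zadj_def by (auto simp flip: ipoly_uminus)

lemma Zadj_diff [intro]: "a \<in> Zadj z \<Longrightarrow> b \<in> Zadj z \<Longrightarrow> a - b \<in> Zadj z"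
  unfolding Zadj_def by (auto simp flip: ipoly_diff)

lemma Zadj_mult [intro]: "a \<in> Zadj z \<Longrightarrow> b \<in> Zadj z \<Longrightarrow> a * b \<in> Zadj z"
  unfolding Zadj_def by (auto simp flip: ipoly_mult)

lemma Zadj_power [intro]: "a \<in> Zadj z \<Longrightarrow> a ^ k \<in> Zadj z"
  by (induction k) auto

lemma Zadj_sum [intro]: "(\<And>i. i \<in> A \<Longrightarrow> f i \<in> Zadj z) \<Longrightarrow> (\<Sum>i\<in>A. f i) \<in> Zadj z"
  by (induction A rule: infinite_finite_induct) auto

lemma Zadj_prod [intro]: "(\<And>i. i \<in> A \<Longrightarrow> f i \<in> Zadj z) \<Longrightarrow> (\<Prod>i\<in>A. f i) \<in> Zadj z"
  by (induction A rule: infinite_finite_induct) auto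

lemma Zadj_ipoly_of [intro]: "a \<in> Zadj z \<Longrightarrow> ipoly P a \<in> Zadj z"
  unfolding ipoly_altdef by auto

text \<open>
  Such a functional replaces a trace form: it turns membership in \<open>\<int>[z]\<close> into a bound on
  denominators without any knowledge of the degree of \<open>z\<close>.
\<close>

lemma ex_rat_functional:
  obtains L :: "complex \<Rightarrow> rat"
  where "\<And>x y. L (x + y) = L x + L y" "\<And>r x. L (of_rat r * x) = r * L x" "L 1 = 1"
proof -
  interpret vector_space "\<lambda>(r::rat) (x::complex). of_rat r * x"
    by unfold_locales (simp_all add: algebra_simps of_rat_add of_rat_mult)
  interpret Q: vector_space "\<lambda>(r::rat) (x::rat). r * x"
    by unfold_locales (simp_all add: algebra_simps)
  interpret vector_space_pair "\<lambda>(r::rat) (x::complex). of_rat r * x" "\<lambda>(r::rat) (x::rat). r * x" ..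
  have ind: "independent {1::complex}" by simp
  define L where "L = construct {1::complex} (\<lambda>_. 1)"
  have "Vector_Spaces.linear (\<lambda>(r::rat) (x::complex). of_rat r * x) (*) L"
    unfolding L_def by (rule linear_construct [OF ind])
  then interpret L: Vector_Spaces.linear "\<lambda>(r::rat) (x::complex). of_rat r * x" "(*)" L .
  show ?thesis
    by (rule that [of L]) (use L.add L.scale construct_basis [OF ind, of 1] in \<open>simp_all add: L_def\<close>)
qed

lemma ex_common_denominator:
  assumes "finite A"
  shows "\<exists>d>0. \<forall>a\<in>A. of_int d * (f a :: rat) \<in> \<int>"
  using assms
proof (induction A rule: finite_induct)
  case empty
  show ?case by (intro exI [of _ 1]) auto
next
  case (insert a A)
  then obtain d where d: "d > 0" "\<And>a. a \<in> A \<Longrightarrow> of_int d * f a \<in> \<int>" by auto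
  obtain u v where uv: "quotient_of (f a) = (u, v)" by (cases "quotient_of (f a)")
  then have v: "v > 0" "f a = of_int u / of_int v"
    using quotient_of_denom_pos quotient_of_div by blast+
  have "of_int (d * v) * f b \<in> \<int>" if "b \<in> insert a A" for b
  proof (cases "b = a")
    case True
    have "of_int (d * v) * f a = of_int (d * u)" using v by simp
    then show ?thesis using True by (metis Ints_of_int)
  next
    case False
    then have "of_int v * (of_int d * f b) \<in> \<int>" using d that by auto
    then show ?thesis by (simp add: mult_ac)
  qed
  then show ?case using d v by (intro exI [of _ "d * v"]) auto
qed

lemma int_eq_0_if_all_powers_dvd:
  fixes b d :: int
  assumes "b > 1" and dvd: "\<And>k. b ^ k dvd d"
  shows "d = 0"
proof (rule ccontr)
  assume "d \<noteq> 0"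
  define k where "k = nat \<bar>d\<bar>"
  have "int k < 2 ^ k" by simp
  also have "(2::int) ^ k \<le> b ^ k" using assms(1) by (intro power_mono) auto
  also have "b ^ k \<le> \<bar>d\<bar>" using dvd_imp_le_int [OF \<open>d \<noteq> 0\<close> dvd [of k]] assms(1) by simp
  finally show False by (simp add: k_def)
qed

lemma rat_in_Ints_if_powers_bounded:
  fixes r :: rat and d :: int
  assumes "d \<noteq> 0" and "\<And>k. of_int d * r ^ k \<in> \<int>"
  shows "r \<in> \<int>"
proof -
  obtain a b where ab: "quotient_of r = (a, b)" by (cases "quotient_of r")
  then have b: "b > 0" "r = of_int a / of_int b" "coprime a b"
    using quotient_of_denom_pos quotient_of_div quotient_of_coprime by blast+
  have dvd: "b ^ k dvd d" for k
  proof -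
    obtain c where "of_int d * r ^ k = of_int c" using assms(2) [of k] Ints_cases by metis
    then have "of_int (d * a ^ k) = (of_int (c * b ^ k) :: rat)"
      using b by (simp add: field_simps power_divide)
    then have "d * a ^ k = c * b ^ k" by (simp only: of_int_eq_iff)
    then have "b ^ k dvd d * a ^ k" by simp
    moreover have "coprime (b ^ k) (a ^ k)" using b by (simp add: coprime_commute)
    ultimately show ?thesis using coprime_dvd_mult_left_iff by blast
  qed
  have "b = 1"
  proof (rule ccontr)
    assume "b \<noteq> 1"
    then have "b > 1" using b(1) by simp
    then show False using int_eq_0_if_all_powers_dvd dvd assms(1) by blast
  qed
  then show ?thesis using b by simp
qed

text \<open>
  All powers of \<open>r\<close> lie in \<open>\<int>[z]\<close>, which is spanned by the finitely many powers of
  \<open>z\<close>. A rational functional \<open>L\<close> with \<open>L 1 = 1\<close> maps this span into the fractions with one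
  fixed denominator \<open>d\<close>, so that \<open>d * r ^ k\<close> is an integer for every \<open>k\<close>.
\<close>

lemma rat_in_Zadj_root_of_unity:
  assumes "z ^ N = 1" "N > 0" "of_rat r \<in> Zadj z"
  shows "r \<in> \<int>"
proof -
  obtain L :: "complex \<Rightarrow> rat" where L: "\<And>x y. L (x + y) = L x + L y"
    "\<And>r x. L (of_rat r * x) = r * L x" "L 1 = 1"
    using ex_rat_functional by blast
  have L0: "L 0 = 0" using L(2) [of 0 0] by simp
  have Lsum: "L (sum f A) = (\<Sum>i\<in>A. L (f i))" for f and A :: "nat set"
    by (induction A rule: infinite_finite_induct) (simp_all add: L L0)
  obtain d where d: "d > 0" "\<And>i. i < N \<Longrightarrow> of_int d * L (z ^ i) \<in> \<int>"
    using ex_common_denominator [of "{..<N}" "\<lambda>i. L (z ^ i)"] by auto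
  have pow: "of_int d * L (z ^ i) \<in> \<int>" for i
  proof -
    have "z ^ i = z ^ (i mod N)"
      using assms(1) by (metis mult_div_mod_eq mult_1 power_add power_mult power_one)
    then show ?thesis using d(2) [of "i mod N"] assms(2) by simp
  qed
  have int: "of_int d * L x \<in> \<int>" if x: "x \<in> Zadj z" for x
  proof -
    obtain P where "x = ipoly P z" using x by (auto simp: Zadj_def)
    then have "L x = (\<Sum>i\<le>degree P. L (of_rat (of_int (coeff P i)) * z ^ i))"
      by (simp add: ipoly_altdef Lsum)
    also have "\<dots> = (\<Sum>i\<le>degree P. of_int (coeff P i) * L (z ^ i))"
      by (simp only: L)
    finally have "of_int d * L x = (\<Sum>i\<le>degree P. of_int (coeff P i) * (of_int d * L (z ^ i)))"
      by (simp add: sum_distrib_left mult_ac)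
    also have "\<dots> \<in> \<int>"
      by (intro Ints_sum Ints_mult pow Ints_of_int)
    finally show ?thesis .
  qed
  have "of_int d * r ^ k \<in> \<int>" for k
  proof -
    have "of_rat (r ^ k) \<in> Zadj z" using assms(3) by (auto simp: of_rat_power)
    moreover have "L (of_rat (r ^ k)) = r ^ k" using L(2) [of "r ^ k" 1] L(3) by simp
    ultimately show ?thesis using int by metis
  qed
  then show ?thesis using rat_in_Ints_if_powers_bounded [of d r] d by simp
qed

lemma Rats_Zadj_Ints:
  assumes "z ^ N = 1" "N > 0" "x \<in> Zadj z" "x \<in> \<rat>"
  shows "x \<in> \<int>"
proof -
  obtain r where "x = of_rat r" using assms(4) by (auto elim: Rats_cases)
  then show ?thesis
    using rat_in_Zadj_root_of_unity [OF assms(1,2), of r] assms(3)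
    by (auto elim!: Ints_cases)
qed

section \<open>Products over roots of unity\<close>

definition has_order :: "complex \<Rightarrow> nat \<Rightarrow> bool"
  where "has_order z N \<longleftrightarrow> N > 0 \<and> z ^ N = 1 \<and> (\<forall>k\<in>{0<..<N}. z ^ k \<noteq> 1)"

lemma has_order_power_eq_1_iff:
  assumes "has_order z N"
  shows "z ^ k = 1 \<longleftrightarrow> N dvd k"
proof
  have z: "N > 0" "z ^ N = 1" using assms by (auto simp: has_order_def)
  have "z ^ k = z ^ (k mod N)"
    using z(2) by (metis mult_div_mod_eq mult_1 power_add power_mult power_one)
  moreover assume "z ^ k = 1"
  ultimately have "k mod N \<notin> {0<..<N}" using assms by (auto simp: has_order_def)
  then show "N dvd k" using z(1) by (simp add: dvd_eq_mod_eq_0)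
next
  assume "N dvd k"
  then show "z ^ k = 1" using assms by (auto simp: has_order_def power_mult elim!: dvdE)
qed

lemma has_order_power_eq_iff:
  assumes "has_order z N"
  shows "z ^ i = z ^ j \<longleftrightarrow> i mod N = j mod N"
proof -
  have z0: "z \<noteq> 0" using assms by (auto simp: has_order_def power_0_left split: if_splits)
  have *: "z ^ i = z ^ j \<longleftrightarrow> i mod N = j mod N" if "i \<le> j" for i j
  proof -
    have "z ^ j = z ^ i * z ^ (j - i)" using that by (metis le_add_diff_inverse power_add)
    then have "z ^ i = z ^ j \<longleftrightarrow> z ^ (j - i) = 1" using z0 by auto
    also have "\<dots> \<longleftrightarrow> i mod N = j mod N"
      unfolding has_order_power_eq_1_iff [OF assms] mod_eq_dvd_iff_nat [OF that, symmetric] by (rule eq_commute)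
    finally show ?thesis .
  qed
  show ?thesis
    using * [of i j] * [of j i] by (cases "i \<le> j") auto
qed

lemma has_order_power:
  assumes "has_order z (p * q)"
  shows "has_order (z ^ p) q"
  unfolding has_order_def
proof (intro conjI ballI)
  have pq: "p > 0" "q > 0" using assms by (auto simp: has_order_def)
  then show "q > 0" by simp
  show "(z ^ p) ^ q = 1" using assms by (simp add: has_order_def flip: power_mult)
  fix k assume "k \<in> {0<..<q}"
  then show "(z ^ p) ^ k \<noteq> 1"
    using pq by (simp add: has_order_power_eq_1_iff [OF assms] nat_dvd_not_less flip: power_mult)
qed

lemma roots_of_unity_eq_powers:
  assumes "has_order z N"
  shows "{w. w ^ N = 1} = (\<lambda>i. z ^ i) ` {..<N}" "inj_on (\<lambda>i. z ^ i) {..<N}"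
proof -
  show inj: "inj_on (\<lambda>i. z ^ i) {..<N}"
    by (rule inj_onI) (simp add: has_order_power_eq_iff [OF assms])
  have N: "N > 0" "z ^ N = 1" using assms by (auto simp: has_order_def)
  have "(\<lambda>i. z ^ i) ` {..<N} = {w. w ^ N = 1}"
  proof (rule card_seteq)
    show "finite {w::complex. w ^ N = 1}" using finite_roots_unity [of N] N by simp
    have "(z ^ i) ^ N = (z ^ N) ^ i" for i by (metis power_mult mult.commute)
    then show "(\<lambda>i. z ^ i) ` {..<N} \<subseteq> {w. w ^ N = 1}" using N by auto
    show "card {w::complex. w ^ N = 1} \<le> card ((\<lambda>i. z ^ i) ` {..<N})"
      using card_roots_unity [of N, where 'a = complex] N by (simp add: card_image [OF inj])
  qed
  then show "{w. w ^ N = 1} = (\<lambda>i. z ^ i) ` {..<N}" by simp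
qed

lemma finite_roots [simp]: "has_order z N \<Longrightarrow> finite {w::complex. w ^ N = 1}"
  by (simp add: roots_of_unity_eq_powers)

lemma card_roots: "has_order z N \<Longrightarrow> card {w::complex. w ^ N = 1} = N"
  by (simp add: roots_of_unity_eq_powers card_image)

lemma root_of_unity_is_power:
  assumes "has_order z N" "w ^ N = 1"
  shows "\<exists>i. w = z ^ i"
proof -
  have "w \<in> (\<lambda>i. z ^ i) ` {..<N}"
    using assms(2) unfolding roots_of_unity_eq_powers(1) [OF assms(1), symmetric] by simp
  then show ?thesis by auto
qed

lemma root_of_unity_in_Zadj: "has_order z N \<Longrightarrow> w ^ N = 1 \<Longrightarrow> w \<in> Zadj z"
  using root_of_unity_is_power by blast

lemma sum_roots_of_unity_power:
  assumes "has_order z N"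
  shows "(\<Sum>w::complex | w ^ N = 1. w ^ i) = (if N dvd i then of_nat N else 0)"
proof -
  have "(\<Sum>w::complex | w ^ N = 1. w ^ i) = (\<Sum>j<N. (z ^ j) ^ i)"
    unfolding roots_of_unity_eq_powers(1) [OF assms]
    by (simp add: sum.reindex [OF roots_of_unity_eq_powers(2) [OF assms]])
  also have "\<dots> = (\<Sum>j<N. (z ^ i) ^ j)"
    by (simp add: mult.commute flip: power_mult)
  also have "\<dots> = (if N dvd i then of_nat N else 0)"
  proof (cases "N dvd i")
    case True
    then have "z ^ i = 1" by (simp add: has_order_power_eq_1_iff [OF assms])
    then show ?thesis using True by simp
  next
    case False
    then have "z ^ i \<noteq> 1" by (simp add: has_order_power_eq_1_iff [OF assms])
    moreover have "(z ^ i) ^ N = 1" by (simp add: has_order_power_eq_1_iff [OF assms] flip: power_mult)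
    ultimately show ?thesis using False by (simp add: sum_gp_strict)
  qed
  finally show ?thesis .
qed

lemma sum_roots_of_unity_ipoly:
  assumes "has_order z N"
  shows "\<exists>c::int. (\<Sum>w | w ^ N = 1. ipoly P w) = of_nat N * of_int c"
proof
  let ?c = "\<Sum>i\<le>degree P. if N dvd i then coeff P i else 0"
  have "(\<Sum>w | w ^ N = 1. ipoly P w) = (\<Sum>i\<le>degree P. of_int (coeff P i) * (\<Sum>w | w ^ N = 1. w ^ i))"
    unfolding ipoly_altdef by (subst sum.swap) (simp add: sum_distrib_left)
  also have "\<dots> = of_nat N * of_int ?c"
    unfolding sum_roots_of_unity_power [OF assms]
    by (simp add: sum_distrib_left if_distrib cong: if_cong) (intro sum.cong, auto)
  finally show "(\<Sum>w | w ^ N = 1. ipoly P w) = of_nat N * of_int ?c" .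
qed

text \<open>
  The logarithmic derivative of \<open>\<Prod>a. 1 + c a * X\<close> is the generating function of the signed power
  sums of the \<open>c a\<close>; in this form Newton's identities need no symmetric polynomials.
\<close>

lemma fps_deriv_prod_linear:
  fixes c :: "'b \<Rightarrow> 'a::comm_ring_1"
  assumes "finite A"
  shows "fps_deriv (\<Prod>a\<in>A. 1 + fps_const (c a) * fps_X) =
    (\<Prod>a\<in>A. 1 + fps_const (c a) * fps_X) * Abs_fps (\<lambda>i. \<Sum>a\<in>A. (-1) ^ i * c a ^ Suc i)"
  using assms
proof (induction A rule: finite_induct)
  case empty
  have "Abs_fps (\<lambda>i. 0 :: 'a) = 0" by (simp add: fps_eq_iff)
  then show ?case by simp
next
  case (insert b A)
  let ?l = "1 + fps_const (c b) * fps_X" and ?f = "\<Prod>a\<in>A. 1 + fps_const (c a) * fps_X"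
  let ?S = "\<lambda>A. Abs_fps (\<lambda>i. \<Sum>a\<in>A. (-1) ^ i * c a ^ Suc i)"
  have geo: "?l * Abs_fps (\<lambda>i. (-1) ^ i * c b ^ Suc i) = fps_const (c b)"
  proof (rule fps_ext)
    fix n show "fps_nth (?l * Abs_fps (\<lambda>i. (-1) ^ i * c b ^ Suc i)) n = fps_nth (fps_const (c b)) n"
      by (cases n) (simp_all add: distrib_right mult.assoc)
  qed
  have S: "?S (insert b A) = Abs_fps (\<lambda>i. (-1) ^ i * c b ^ Suc i) + ?S A"
    using insert.hyps by (simp add: fps_eq_iff)
  have "(?l * ?f) * ?S (insert b A) =
      (?l * Abs_fps (\<lambda>i. (-1) ^ i * c b ^ Suc i)) * ?f + ?l * (?f * ?S A)"
    unfolding S by (simp only: distrib_left mult_ac)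
  also have "\<dots> = fps_const (c b) * ?f + ?l * (?f * ?S A)"
    by (simp only: geo)
  also have "\<dots> = fps_deriv (?l * ?f)"
    using insert.IH by (simp add: add.commute)
  finally show ?case using insert.hyps by simp
qed

text \<open>
  With \<open>S\<close> the generating function of the signed power sums, \<open>f' = f * S\<close>. A power sum of the values of an
  integer polynomial at all \<open>N\<close>-th roots of unity is an integer multiple of \<open>N\<close>. The identity thus
  shows inductively that the coefficients of \<open>f\<close> are rational, hence integers because they lie in
  \<open>\<int>[z]\<close>, and then that \<open>N\<close> divides the coefficients of \<open>f'\<close>.
\<close>

lemma coeff_prod_roots_of_unity:
  fixes P :: "int poly"
  assumes z: "has_order z N"
  defines "f \<equiv> \<Prod>w | w ^ N = 1. [:1, ipoly P w:]"
  shows "\<exists>a::int. coeff f j = of_int a \<and> int N dvd int j * a"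
proof -
  let ?A = "{w::complex. w ^ N = 1}"
  let ?S = "\<lambda>i. \<Sum>w\<in>?A. (-1) ^ i * ipoly P w ^ Suc i"
  have z1: "z ^ N = 1" "N > 0" using z by (auto simp: has_order_def)
  have Zadj: "coeff f j \<in> Zadj z" for j
  proof -
    have "finite B \<Longrightarrow> B \<subseteq> ?A \<Longrightarrow> coeff (\<Prod>w\<in>B. [:1, ipoly P w:]) j \<in> Zadj z" for B
    proof (induction B arbitrary: j rule: finite_induct)
      case empty
      show ?case by (cases j) auto
    next
      case (insert b B)
      have "ipoly P b \<in> Zadj z" using insert.prems z by (intro Zadj_ipoly_of root_of_unity_in_Zadj) auto
      moreover have "coeff (\<Prod>w\<in>B. [:1, ipoly P w:]) j \<in> Zadj z" for j using insert by auto
      ultimately show ?case using insert.hyps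
        by (cases j) (auto simp: coeff_pCons split: nat.splits)
    qed
    then show ?thesis using finite_roots [OF z] by (auto simp: f_def)
  qed
  have "fps_deriv (fps_of_poly f) = fps_of_poly f * Abs_fps ?S"
    using fps_deriv_prod_linear [OF finite_roots [OF z], of "ipoly P"]
    by (simp add: f_def fps_of_poly_prod fps_of_poly_linear')
  then have "fps_nth (fps_deriv (fps_of_poly f)) j = fps_nth (fps_of_poly f * Abs_fps ?S) j" for j
    by simp
  then have rec: "of_nat (Suc j) * coeff f (Suc j) = (\<Sum>i=0..j. coeff f i * ?S (j - i))" for j
    unfolding fps_deriv_nth fps_mult_nth by simp
  have "\<exists>c::int. ?S i = of_nat N * of_int c" for i
  proof -
    obtain c :: int where "(\<Sum>w\<in>?A. ipoly (P ^ Suc i) w) = of_nat N * of_int c"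
      using sum_roots_of_unity_ipoly [OF z] by blast
    then have "?S i = of_nat N * of_int ((-1) ^ i * c)"
      by (simp add: sum_distrib_left [symmetric])
    then show ?thesis by blast
  qed
  then obtain s :: "nat \<Rightarrow> int" where s: "\<And>i. ?S i = of_nat N * of_int (s i)" by metis
  show ?thesis
  proof (induction j rule: less_induct)
    case (less j)
    show ?case
    proof (cases j)
      case 0
      have "coeff f 0 = 1" by (simp add: f_def poly_0_coeff_0 [symmetric] poly_prod)
      then show ?thesis using 0 by (intro exI [of _ 1]) simp
    next
      case (Suc k)
      obtain a where a: "\<And>i. i < j \<Longrightarrow> coeff f i = of_int (a i)" using less by metis
      let ?t = "\<Sum>i=0..k. a i * s (k - i)"
      have "of_nat (Suc k) * coeff f (Suc k) = (\<Sum>i=0..k. of_int (a i) * (of_nat N * of_int (s (k - i))))"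
        unfolding rec s using a Suc by (intro sum.cong) auto
      also have "\<dots> = of_int (int N * ?t)" by (simp add: sum_distrib_left mult_ac)
      finally have t: "of_nat j * coeff f j = of_int (int N * ?t)" using Suc by simp
      moreover have "(of_nat j :: complex) \<noteq> 0" using Suc by (simp del: of_nat_Suc)
      ultimately have "coeff f j = of_int (int N * ?t) / of_nat j"
        by (simp only: eq_divide_eq mult.commute simp_thms if_False if_True)
      then have "coeff f j \<in> \<rat>" by (metis Rats_divide Rats_of_int Rats_of_nat)
      then have "coeff f j \<in> \<int>" using Rats_Zadj_Ints [OF z1 Zadj] by blast
      then obtain b where b: "coeff f j = of_int b" by (auto elim: Ints_cases)
      then have "of_int (int j * b) = (of_int (int N * ?t) :: complex)" using t by simp
      then have "int j * b = int N * ?t" by (simp only: of_int_eq_iff)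
      then show ?thesis using b by auto
    qed
  qed
qed

text \<open>
  This product is the determinant of multiplication by \<open>P\<close> on \<open>\<int>[x]/(x\<^sup>N - 1)\<close>; here it appears as
  the top coefficient of the polynomial treated above.
\<close>

lemma prod_roots_of_unity_Ints:
  assumes z: "has_order z N"
  shows "(\<Prod>w | w ^ N = 1. ipoly P w) \<in> \<int>"
proof -
  let ?A = "{w::complex. w ^ N = 1}"
  have "finite B \<Longrightarrow> coeff (\<Prod>w\<in>B. [:1, ipoly P w:]) (card B) = (\<Prod>w\<in>B. ipoly P w) \<and>
      degree (\<Prod>w\<in>B. [:1, ipoly P w:]) \<le> card B" for B
  proof (induction B rule: finite_induct)
    case (insert b B)
    have "coeff (\<Prod>w\<in>B. [:1, ipoly P w:]) (Suc (card B)) = 0"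
      using insert.IH by (intro coeff_eq_0) auto
    moreover have "degree ([:1, ipoly P b:] * (\<Prod>w\<in>B. [:1, ipoly P w:])) \<le> 1 + card B"
      using insert.IH by (intro order.trans [OF degree_mult_le] add_mono) auto
    ultimately show ?case using insert by simp
  qed simp
  then have "(\<Prod>w\<in>?A. ipoly P w) = coeff (\<Prod>w\<in>?A. [:1, ipoly P w:]) N"
    using finite_roots [OF z] card_roots [OF z] by metis
  then show ?thesis using coeff_prod_roots_of_unity [OF z, of P N] by auto
qed

text \<open>
  Dividing by \<open>j\<close> loses the factor \<open>p ^ multiplicity p j\<close>, and the exponent here is less than \<open>j\<close>;
  so \<open>p ^ j\<close> repays the loss and one more \<open>p\<close>.
\<close>

lemma prime_power_dvd_mult_cancel:
  fixes a :: int
  assumes p: "prime p" and dvd: "int p ^ k dvd int j * a" and j: "j > 0"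
  shows "int p ^ Suc k dvd int p ^ j * a"
proof -
  define m where "m = multiplicity p j"
  have "\<not> is_unit p" using p by auto
  then obtain b where b: "j = p ^ m * b" "\<not> p dvd b"
    using multiplicity_decompose' [of j p] j unfolding m_def by blast
  have "coprime p b" using b(2) p by (simp add: prime_imp_coprime)
  then have cop: "coprime (int p ^ k) (int b)" by simp
  have "int p ^ k dvd (int p ^ m * a) * int b" using dvd by (simp add: b mult_ac)
  then have "int p ^ k dvd int p ^ m * a" using coprime_dvd_mult_left_iff [OF cop] by blast
  then have "int p * int p ^ k dvd int p * (int p ^ m * a)" by (rule mult_dvd_mono [OF dvd_refl])
  then have "int p ^ Suc k dvd int p ^ Suc m * a" by (simp only: power_Suc mult.assoc)
  also have "\<dots> dvd int p ^ j * a"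
  proof (intro mult_dvd_mono le_imp_power_dvd dvd_refl Suc_leI)
    have "m < p ^ m" using prime_gt_1_nat [OF p] by (intro power_gt_expt) auto
    also have "p ^ m \<le> j" using b j by (intro dvd_imp_le) auto
    finally show "m < j" .
  qed
  finally show ?thesis .
qed

text \<open>
  This is where a congruence modulo \<open>p\<close> improves to one modulo \<open>p ^ (k + 1)\<close>. Expand the product in
  powers of \<open>p\<close>: the \<open>j\<close>-th coefficient \<open>a j\<close> satisfies \<open>p ^ k dvd j * a j\<close>, which makes every
  term after the first divisible by \<open>p ^ (k + 1)\<close>.
\<close>

lemma prod_roots_of_unity_cong_1:
  assumes p: "prime p" and z: "has_order z (p ^ k)"
  shows "\<exists>c::int. (\<Prod>w | w ^ (p ^ k) = 1. 1 + of_nat p * ipoly P w) = of_int (1 + int p ^ Suc k * c)"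
proof -
  define f where "f = (\<Prod>w | w ^ (p ^ k) = 1. [:1, ipoly P w:])"
  obtain a :: "nat \<Rightarrow> int" where a: "\<And>j. coeff f j = of_int (a j)" "\<And>j. int (p ^ k) dvd int j * a j"
    using coeff_prod_roots_of_unity [OF z, of P] unfolding f_def by metis
  have "coeff f 0 = 1" by (simp add: f_def poly_0_coeff_0 [symmetric] poly_prod)
  then have a0: "a 0 = 1" using a(1) [of 0] by simp
  have "(\<Prod>w | w ^ (p ^ k) = 1. 1 + of_nat p * ipoly P w) = poly f (of_nat p)"
    by (simp add: f_def poly_prod)
  also have "\<dots> = of_int (\<Sum>j\<le>degree f. int p ^ j * a j)"
    by (simp add: poly_altdef a mult.commute)
  also have "(\<Sum>j\<le>degree f. int p ^ j * a j) = 1 + (\<Sum>j\<in>{1..degree f}. int p ^ j * a j)"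
    by (simp add: atMost_atLeast0 sum.atLeast_Suc_atMost a0)
  also have "int p ^ Suc k dvd (\<Sum>j\<in>{1..degree f}. int p ^ j * a j)"
    using a(2) by (intro dvd_sum prime_power_dvd_mult_cancel p) auto
  then obtain c where "(\<Sum>j\<in>{1..degree f}. int p ^ j * a j) = int p ^ Suc k * c" ..
  finally show ?thesis by blast
qed

section \<open>Irreducibility of prime-power cyclotomic polynomials\<close>

text \<open>
  For \<open>q = p ^ m\<close> with \<open>p\<close> prime this is the cyclotomic polynomial of index \<open>p ^ (m + 1)\<close>.
\<close>

definition cyclo :: "nat \<Rightarrow> nat \<Rightarrow> int poly"
  where "cyclo p q = (\<Sum>i<p. monom 1 (i * q))"

lemma cyclo_mult: "cyclo p q * (monom 1 q - 1) = monom 1 (p * q) - 1"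
proof -
  have "cyclo p q * (monom 1 q - 1) = (\<Sum>i<p. monom 1 (Suc i * q) - monom 1 (i * q))"
    unfolding cyclo_def sum_distrib_right
    by (intro sum.cong refl) (simp add: right_diff_distrib mult_monom add.commute)
  also have "\<dots> = monom 1 (p * q) - monom 1 (0 * q)"
    by (rule sum_lessThan_telescope)
  finally show ?thesis by simp
qed

lemma degree_monom_diff_1:
  assumes "k > 0"
  shows "degree (monom 1 k - 1 :: int poly) = k" "lead_coeff (monom 1 k - 1 :: int poly) = 1"
proof -
  have "degree (monom 1 k + (- 1) :: int poly) = degree (monom 1 k :: int poly)"
    using assms by (intro degree_add_eq_left) (simp add: degree_monom_eq)
  then show *: "degree (monom 1 k - 1 :: int poly) = k" by (simp add: degree_monom_eq)
  show "lead_coeff (monom 1 k - 1 :: int poly) = 1" unfolding * using assms by simp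
qed

lemma
  assumes "p > 0" "q > 0"
  shows degree_cyclo: "degree (cyclo p q) = (p - 1) * q" and lead_coeff_cyclo: "lead_coeff (cyclo p q) = 1"
proof -
  have nz: "monom 1 (p * q) - 1 \<noteq> (0 :: int poly)"
    using degree_monom_diff_1(2) [of "p * q"] assms by auto
  then have nz': "cyclo p q \<noteq> 0" "monom 1 q - 1 \<noteq> (0 :: int poly)"
    unfolding cyclo_mult [symmetric] by auto
  have "degree (cyclo p q) + degree (monom 1 q - 1 :: int poly) = degree (monom 1 (p * q) - 1 :: int poly)"
    using degree_mult_eq [OF nz'] by (simp add: cyclo_mult)
  then show "degree (cyclo p q) = (p - 1) * q"
    using assms by (simp add: degree_monom_diff_1 algebra_simps)
  have "lead_coeff (cyclo p q) * lead_coeff (monom 1 q - 1) = lead_coeff (monom 1 (p * q) - 1)"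
    by (simp only: cyclo_mult lead_coeff_mult [symmetric])
  then show "lead_coeff (cyclo p q) = 1"
    using degree_monom_diff_1(2) [of "p * q"] degree_monom_diff_1(2) [of q] assms by simp
qed

lemma ipoly_cyclo_1:
  assumes "z ^ q = 1"
  shows "ipoly (cyclo p q) z = of_nat p"
proof -
  have "z ^ (i * q) = 1" for i using assms by (metis mult.commute power_mult power_one)
  then show ?thesis by (simp add: cyclo_def)
qed

lemma ipoly_cyclo_0:
  assumes "z ^ (p * q) = 1" "z ^ q \<noteq> 1"
  shows "ipoly (cyclo p q) z = 0"
proof -
  have "ipoly (cyclo p q * (monom 1 q - 1)) z = 0"
    unfolding cyclo_mult using assms(1) by simp
  then show ?thesis using assms(2) by simp
qed

text \<open>
  The polynomial \<open>cyclo p q\<close> is monic and its roots are exactly these \<open>w\<close>; the product is its value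
  at \<open>1\<close>.
\<close>

lemma prod_one_minus_roots:
  assumes z: "has_order z (p * q)"
  shows "(\<Prod>w::complex | w ^ (p * q) = 1 \<and> w ^ q \<noteq> 1. 1 - w) = of_nat p"
    and "card {w::complex. w ^ (p * q) = 1 \<and> w ^ q \<noteq> 1} = (p - 1) * q"
proof -
  let ?A = "{w::complex. w ^ (p * q) = 1 \<and> w ^ q \<noteq> 1}"
  have pq: "p > 0" "q > 0" using z by (auto simp: has_order_def)
  have fin: "finite ?A" using finite_roots [OF z] by (rule rev_finite_subset) auto
  have "w ^ (p * q) = 1" if "w ^ q = 1" for w :: complex
    using that by (metis mult.commute power_mult power_one)
  then have "?A = {w. w ^ (p * q) = 1} - {w. w ^ q = 1}" "{w::complex. w ^ q = 1} \<subseteq> {w. w ^ (p * q) = 1}"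
    by auto
  then have "card ?A = p * q - q"
    using card_roots [OF z] card_roots [OF has_order_power [OF z]] finite_roots [OF has_order_power [OF z]]
    by (simp add: card_Diff_subset)
  then show card: "card ?A = (p - 1) * q" using pq by (simp add: algebra_simps)
  have linear: "degree (\<Prod>w\<in>B. [:- w, 1:]) = card B" "lead_coeff (\<Prod>w\<in>B. [:- w, 1:]) = 1"
    if "finite B" for B :: "complex set"
  proof -
    show "degree (\<Prod>w\<in>B. [:- w, 1:]) = card B" by (simp add: degree_prod_eq_sum_degree)
    show "lead_coeff (\<Prod>w\<in>B. [:- w, 1:]) = 1" by (simp only: lead_coeff_prod) simp
  qed
  have deg: "degree (\<Prod>w\<in>?A. [:- w, 1:]) = (p - 1) * q" "lead_coeff (\<Prod>w\<in>?A. [:- w, 1:]) = 1"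
    using linear(1) [OF fin] card linear(2) [OF fin] by simp_all
  \<comment> \<open>Two monic polynomials of the same degree that agree at as many points.\<close>
  have "map_poly of_int (cyclo p q) = (\<Prod>w\<in>?A. [:- w, 1:])"
  proof (rule poly_eqI_degree_lead_coeff [where n = "(p - 1) * q" and A = ?A])
    show "coeff (map_poly of_int (cyclo p q)) ((p - 1) * q) = coeff (\<Prod>w\<in>?A. [:- w, 1:]) ((p - 1) * q)"
      using deg lead_coeff_cyclo [OF pq] by (simp add: coeff_map_poly degree_cyclo [OF pq])
    show "ipoly (cyclo p q) w = poly (\<Prod>w\<in>?A. [:- w, 1:]) w" if "w \<in> ?A" for w
      using that fin by (auto simp: ipoly_cyclo_0 poly_prod)
  qed (use card deg pq in \<open>auto simp: degree_map_poly degree_cyclo\<close>)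
  then have "ipoly (cyclo p q) 1 = (\<Prod>w\<in>?A. 1 - w)" by (simp add: poly_prod)
  then show "(\<Prod>w\<in>?A. 1 - w) = of_nat p" by (simp add: ipoly_cyclo_1)
qed

text \<open>
  Each of \<open>w\<close> and \<open>z\<close> is a power of the other, and \<open>1 - u\<close> divides \<open>1 - u ^ k\<close> for every \<open>u\<close>.
\<close>

lemma one_minus_root_associated:
  assumes p: "prime p" and z: "has_order z (p ^ Suc m)" and w: "w ^ (p ^ Suc m) = 1" "w ^ (p ^ m) \<noteq> 1"
  shows "\<exists>a\<in>Zadj z. 1 - w = (1 - z) * a" "\<exists>b\<in>Zadj z. 1 - z = (1 - w) * b"
proof -
  obtain k where k: "w = z ^ k"
    using root_of_unity_is_power [OF z w(1)] by blast
  have "\<not> p dvd k"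
  proof
    assume "p dvd k"
    then obtain l where l: "k = p * l" by (elim dvdE)
    then have "k * p ^ m = p ^ Suc m * l" by simp
    then have "w ^ (p ^ m) = (z ^ (p ^ Suc m)) ^ l" unfolding k by (metis power_mult)
    moreover have "z ^ (p ^ Suc m) = 1" using z by (auto simp only: has_order_def)
    ultimately show False using w(2) by (simp only: power_one simp_thms)
  qed
  then have "coprime k (p ^ Suc m)"
    using p by (metis coprime_commute coprime_power_right_iff prime_imp_coprime)
  then obtain x where "[k * x = Suc 0] (mod p ^ Suc m)" using cong_solve_coprime_nat by blast
  then have "w ^ x = z ^ 1"
    unfolding k power_mult [symmetric] has_order_power_eq_iff [OF z] by (simp add: cong_def)
  then have "1 - z = (1 - w) * (\<Sum>i<x. w ^ i)" by (simp add: one_diff_power_eq [symmetric])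
  moreover have "(\<Sum>i<x. w ^ i) \<in> Zadj z" unfolding k by auto
  ultimately show "\<exists>b\<in>Zadj z. 1 - z = (1 - w) * b" by blast
  have "1 - w = (1 - z) * (\<Sum>i<k. z ^ i)" by (simp add: k one_diff_power_eq)
  then show "\<exists>a\<in>Zadj z. 1 - w = (1 - z) * a" by blast
qed

text \<open>
  Total ramification: \<open>p\<close> is the product of the associated elements \<open>1 - w\<close>, hence it generates the
  same ideal of \<open>\<int>[z]\<close> as the corresponding power of \<open>1 - z\<close>.
\<close>

lemma prime_associated_power:
  assumes p: "prime p" and z: "has_order z (p ^ Suc m)"
  shows "\<exists>a\<in>Zadj z. of_nat p = (1 - z) ^ ((p - 1) * p ^ m) * a"
    and "\<exists>b\<in>Zadj z. (1 - z) ^ ((p - 1) * p ^ m) = of_nat p * b"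
proof -
  let ?A = "{w::complex. w ^ (p * p ^ m) = 1 \<and> w ^ p ^ m \<noteq> 1}"
  have z': "has_order z (p * p ^ m)" using z by simp
  note prod = prod_one_minus_roots [OF z']
  have "\<forall>w\<in>?A. \<exists>a. a \<in> Zadj z \<and> 1 - w = (1 - z) * a"
    using one_minus_root_associated(1) [OF p z] unfolding power_Suc by blast
  then obtain a where "\<forall>w\<in>?A. a w \<in> Zadj z \<and> 1 - w = (1 - z) * a w" by (rule bchoice [THEN exE])
  then have a: "\<And>w. w \<in> ?A \<Longrightarrow> a w \<in> Zadj z" "\<And>w. w \<in> ?A \<Longrightarrow> 1 - w = (1 - z) * a w" by blast+
  have "\<forall>w\<in>?A. \<exists>b. b \<in> Zadj z \<and> 1 - z = (1 - w) * b"
    using one_minus_root_associated(2) [OF p z] unfolding power_Suc by blast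
  then obtain b where "\<forall>w\<in>?A. b w \<in> Zadj z \<and> 1 - z = (1 - w) * b w" by (rule bchoice [THEN exE])
  then have b: "\<And>w. w \<in> ?A \<Longrightarrow> b w \<in> Zadj z" "\<And>w. w \<in> ?A \<Longrightarrow> 1 - z = (1 - w) * b w" by blast+
  have "of_nat p = (\<Prod>w\<in>?A. (1 - z) * a w)" unfolding prod(1) [symmetric] using a(2) by (rule prod.cong [OF refl])
  also have "\<dots> = (1 - z) ^ ((p - 1) * p ^ m) * (\<Prod>w\<in>?A. a w)" by (simp add: prod.distrib prod(2))
  finally show "\<exists>a\<in>Zadj z. of_nat p = (1 - z) ^ ((p - 1) * p ^ m) * a" using a(1) by blast
  have "(1 - z) ^ ((p - 1) * p ^ m) = (\<Prod>w\<in>?A. 1 - z)" by (simp add: prod(2))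
  also have "\<dots> = (\<Prod>w\<in>?A. (1 - w) * b w)" using b(2) by (rule prod.cong [OF refl])
  also have "\<dots> = of_nat p * (\<Prod>w\<in>?A. b w)" by (simp only: prod.distrib prod(1))
  finally show "\<exists>b\<in>Zadj z. (1 - z) ^ ((p - 1) * p ^ m) = of_nat p * b" using b(1) by blast
qed

text \<open>
  A power of \<open>1 - z\<close> is divisible by \<open>p\<close>, so some power of \<open>c\<close> is divisible by \<open>p\<close> in \<open>\<int>[z]\<close>;
  the quotient is rational, hence an integer.
\<close>

lemma prime_dvd_if_one_minus_root_dvd:
  assumes p: "prime p" and z: "has_order z (p ^ Suc m)" and y: "y \<in> Zadj z" "of_int c = (1 - z) * y"
  shows "int p dvd c"
proof -
  define h where "h = (p - 1) * p ^ m"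
  obtain b where b: "b \<in> Zadj z" "(1 - z) ^ h = of_nat p * b"
    using prime_associated_power(2) [OF p z] unfolding h_def by blast
  have z1: "z ^ (p ^ Suc m) = 1" "p ^ Suc m > 0" using z by (auto simp: has_order_def)
  have p0: "p > 0" using p by (rule prime_gt_0_nat)
  have eq: "of_int (c ^ h) = of_nat p * (b * y ^ h)"
    using y(2) b(2) by (simp add: power_mult_distrib)
  then have "b * y ^ h = of_int (c ^ h) / of_nat p" using p0 by (simp add: field_simps)
  then have "b * y ^ h \<in> \<rat>" by simp
  moreover have "b * y ^ h \<in> Zadj z" using b y by auto
  ultimately obtain d where "b * y ^ h = of_int d" using Rats_Zadj_Ints [OF z1] by (metis Ints_cases)
  then have "of_int (c ^ h) = (of_int (int p * d) :: complex)" using eq by simp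
  then have "c ^ h = int p * d" by (simp only: of_int_eq_iff)
  then have "int p dvd c ^ h" by simp
  then show ?thesis using p prime_dvd_power [of "int p" c h] by simp
qed

text \<open>
  The Eisenstein argument read as a valuation argument at \<open>1 - z\<close>: if the coefficients before the
  \<open>i\<close>-th are divisible by \<open>p\<close>, then every term of \<open>T (1 - z)\<close> except the \<open>i\<close>-th is divisible by
  \<open>(1 - z) ^ (i + 1)\<close>, and so is the \<open>i\<close>-th.
\<close>

lemma prime_dvd_coeffs:
  assumes p: "prime p" and z: "has_order z (p ^ Suc m)"
    and T: "\<And>i. i \<ge> (p - 1) * p ^ m \<Longrightarrow> coeff T i = 0" "ipoly T (1 - z) = 0"
  shows "int p dvd coeff T i"
proof (induction i rule: less_induct)
  case (less i)
  define h where "h = (p - 1) * p ^ m"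
  define t where "t = 1 - z"
  have tZ: "t \<in> Zadj z" by (auto simp: t_def)
  have "p ^ Suc m > 1" using prime_gt_1_nat [OF p] by (rule one_less_power) simp
  then have t0: "t \<noteq> 0" using has_order_power_eq_1_iff [OF z, of 1] by (auto simp: t_def simp del: power_Suc)
  obtain a where a: "a \<in> Zadj z" "of_nat p = t ^ h * a"
    using prime_associated_power(1) [OF p z] unfolding h_def t_def by blast
  show ?case
  proof (cases "i < h")
    case False
    then show ?thesis using T(1) by (simp add: h_def)
  next
    case i: True
    have "\<exists>y\<in>Zadj z. of_int (coeff T j) * t ^ j = t ^ Suc i * y" if "j \<noteq> i" for j
    proof (cases "j < i")
      case True
      then obtain c where "coeff T j = int p * c" using less.IH [OF True] by (elim dvdE)
      then have "of_int (coeff T j) * t ^ j = t ^ h * (a * of_int c * t ^ j)"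
        using a(2) by simp
      also have "t ^ h = t ^ Suc i * t ^ (h - Suc i)"
        using i by (metis Suc_leI le_add_diff_inverse power_add)
      finally have "of_int (coeff T j) * t ^ j = t ^ Suc i * (t ^ (h - Suc i) * (a * of_int c * t ^ j))"
        by (simp only: mult.assoc)
      then show ?thesis using a(1) tZ by blast
    next
      case False
      then have "t ^ j = t ^ Suc i * t ^ (j - Suc i)"
        using that by (metis Suc_leI le_add_diff_inverse linorder_neqE_nat power_add)
      then have "of_int (coeff T j) * t ^ j = t ^ Suc i * (of_int (coeff T j) * t ^ (j - Suc i))"
        by (simp only: mult_ac)
      then show ?thesis using tZ by blast
    qed
    then obtain y where y: "\<And>j. j \<noteq> i \<Longrightarrow> y j \<in> Zadj z"
      "\<And>j. j \<noteq> i \<Longrightarrow> of_int (coeff T j) * t ^ j = t ^ Suc i * y j" by metis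
    define D where "D = max i (degree T)"
    have "0 = (\<Sum>j\<le>degree T. of_int (coeff T j) * t ^ j)" using T(2) by (simp add: ipoly_altdef t_def)
    also have "\<dots> = (\<Sum>j\<le>D. of_int (coeff T j) * t ^ j)"
      by (rule sum.mono_neutral_left) (auto simp: D_def coeff_eq_0)
    also have "\<dots> = of_int (coeff T i) * t ^ i + (\<Sum>j\<in>{..D} - {i}. of_int (coeff T j) * t ^ j)"
      by (rule sum.remove) (auto simp: D_def)
    also have "(\<Sum>j\<in>{..D} - {i}. of_int (coeff T j) * t ^ j) = t ^ Suc i * (\<Sum>j\<in>{..D} - {i}. y j)"
      unfolding sum_distrib_left using y(2) by (intro sum.cong) auto
    finally have "t ^ i * of_int (coeff T i) = t ^ i * (t * (- (\<Sum>j\<in>{..D} - {i}. y j)))"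
      by (simp add: algebra_simps eq_neg_iff_add_eq_0)
    moreover have "t ^ i \<noteq> 0" using t0 by simp
    ultimately have "of_int (coeff T i) = t * (- (\<Sum>j\<in>{..D} - {i}. y j))"
      using mult_left_cancel by blast
    moreover have "- (\<Sum>j\<in>{..D} - {i}. y j) \<in> Zadj z" using y(1) by auto
    ultimately show ?thesis
      unfolding t_def by (intro prime_dvd_if_one_minus_root_dvd [OF p z])
  qed
qed

text \<open>
  Infinite descent on powers of \<open>p\<close>: after the substitution \<open>x \<mapsto> 1 - x\<close>, which is its own inverse,
  all coefficients are divisible by \<open>p\<close>, and the quotient again vanishes at \<open>z\<close>.
\<close>

lemma low_degree_vanishing_eq_0:
  assumes p: "prime p" and z: "has_order z (p ^ Suc m)"
    and S: "degree S < (p - 1) * p ^ m" "ipoly S z = 0"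
  shows "S = 0"
proof -
  let ?r = "[:1, -1:] :: int poly"
  have rr: "pcompose ?r ?r = [:0, 1:]" by (simp add: pcompose_pCons)
  have dvd: "\<exists>S'. S = smult (int p) S'" if S: "degree S < (p - 1) * p ^ m" "ipoly S z = 0" for S
  proof -
    define T where "T = pcompose S ?r"
    have "degree T \<le> degree S" unfolding T_def by (rule order.trans [OF degree_pcompose_le]) simp
    then have "int p dvd coeff T i" for i
      using S by (intro prime_dvd_coeffs [OF p z]) (auto simp: T_def intro: coeff_eq_0)
    then have "[:int p:] dvd T" by (simp add: const_poly_dvd_iff)
    then obtain U where "T = smult (int p) U" by (auto elim!: dvdE)
    then have "pcompose T ?r = smult (int p) (pcompose U ?r)" by (simp add: pcompose_smult)
    moreover have "pcompose T ?r = S" unfolding T_def by (simp add: rr flip: pcompose_assoc)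
    ultimately show ?thesis by blast
  qed
  have p1: "int p > 1" using prime_gt_1_nat [OF p] by simp
  have "\<exists>S'. S = smult (int p ^ k) S'" for k
  proof (induction k)
    case (Suc k)
    then obtain S' where S': "S = smult (int p ^ k) S'" by blast
    then have "degree S' < (p - 1) * p ^ m" "ipoly S' z = 0" using S p1 by simp_all
    then obtain S'' where "S' = smult (int p) S''" using dvd by blast
    then show ?case using S' by (auto simp: mult.commute)
  qed (auto intro: exI [of _ S])
  then have "int p ^ k dvd lead_coeff S" for k by (metis coeff_smult dvd_triv_left)
  then have "lead_coeff S = 0" by (rule int_eq_0_if_all_powers_dvd [OF p1])
  then show ?thesis by simp
qed

text \<open>
  Division by the monic \<open>cyclo p (p ^ m)\<close> stays within the integer polynomials, and the remainder is
  too short to vanish at \<open>z\<close>.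
\<close>

theorem cyclo_dvd_if_vanishing:
  assumes p: "prime p" and z: "has_order z (p ^ Suc m)" and P: "ipoly P z = 0"
  shows "cyclo p (p ^ m) dvd P"
proof -
  let ?F = "cyclo p (p ^ m)"
  have pq: "p > 0" "p ^ m > 0" using prime_gt_0_nat [OF p] by auto
  have F0: "?F \<noteq> 0" using lead_coeff_cyclo [OF pq] by auto
  obtain R S where RS: "pseudo_divmod P ?F = (R, S)" by (cases "pseudo_divmod P ?F")
  have eq: "P = ?F * R + S"
    using pseudo_divmod(1) [OF F0 RS] lead_coeff_cyclo [OF pq] by simp
  have "\<not> p ^ Suc m dvd p ^ m"
    using prime_gt_1_nat [OF p] pq by (auto dest!: dvd_imp_le)
  then have "z ^ (p ^ m) \<noteq> 1" using has_order_power_eq_1_iff [OF z] by blast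
  moreover have "z ^ (p * p ^ m) = 1" using z by (simp add: has_order_def)
  ultimately have "ipoly S z = 0" using P ipoly_cyclo_0 [of z p "p ^ m"] by (simp add: eq)
  moreover have "degree S < (p - 1) * p ^ m \<or> S = 0"
    using pseudo_divmod(2) [OF F0 RS] degree_cyclo [OF pq] by auto
  ultimately have "S = 0" using low_degree_vanishing_eq_0 [OF p z] by blast
  then show ?thesis using eq by simp
qed

section \<open>Group rings of cyclic groups\<close>

text \<open>
  A multiplicative character of \<open>G\<close> extends linearly to a ring homomorphism on the group ring.
\<close>

lemma (in group) group_ring_character_mult:
  fixes \<chi> :: "'a \<Rightarrow> complex"
  assumes fin: "finite (carrier G)" and f: "f \<in> carrier (integral_group_ring G)"
    and \<chi>: "\<And>x y. x \<in> carrier G \<Longrightarrow> y \<in> carrier G \<Longrightarrow> \<chi> (x \<otimes> y) = \<chi> x * \<chi> y"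
  shows "(\<Sum>x\<in>carrier G. of_int ((f \<otimes>\<^bsub>integral_group_ring G\<^esub> h) x) * \<chi> x) =
    (\<Sum>x\<in>carrier G. of_int (f x) * \<chi> x) * (\<Sum>x\<in>carrier G. of_int (h x) * \<chi> x)"
proof -
  have supp: "{x. f x \<noteq> 0} \<subseteq> carrier G" using f by (simp add: integral_group_ring_def)
  have shift: "(\<Sum>x\<in>carrier G. of_int (h (inv y \<otimes> x)) * \<chi> x) = \<chi> y * (\<Sum>x\<in>carrier G. of_int (h x) * \<chi> x)"
    if y: "y \<in> carrier G" for y
  proof -
    have "(\<Sum>x\<in>carrier G. of_int (h (inv y \<otimes> x)) * \<chi> x) = (\<Sum>w\<in>carrier G. of_int (h w) * \<chi> (y \<otimes> w))"
      by (rule sum.reindex_bij_witness [where i = "\<lambda>w. y \<otimes> w" and j = "\<lambda>x. inv y \<otimes> x"])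
        (use y in \<open>auto simp flip: m_assoc\<close>)
    also have "\<dots> = (\<Sum>w\<in>carrier G. \<chi> y * (of_int (h w) * \<chi> w))"
      using y by (intro sum.cong) (auto simp: \<chi>)
    finally show ?thesis by (simp add: sum_distrib_left)
  qed
  have "(\<Sum>x\<in>carrier G. of_int ((f \<otimes>\<^bsub>integral_group_ring G\<^esub> h) x) * \<chi> x) =
      (\<Sum>x\<in>carrier G. \<Sum>y\<in>carrier G. of_int (f y) * (of_int (h (inv y \<otimes> x)) * \<chi> x))"
    by (intro sum.cong refl)
      (simp add: group_ring_mult_eq [OF fin supp] sum_distrib_right mult.assoc)
  also have "\<dots> = (\<Sum>y\<in>carrier G. of_int (f y) * (\<Sum>x\<in>carrier G. of_int (h (inv y \<otimes> x)) * \<chi> x))"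
    by (subst sum.swap) (simp add: sum_distrib_left)
  also have "\<dots> = (\<Sum>y\<in>carrier G. (of_int (f y) * \<chi> y) * (\<Sum>x\<in>carrier G. of_int (h x) * \<chi> x))"
    by (intro sum.cong refl) (simp add: shift mult.assoc)
  finally show ?thesis by (simp add: sum_distrib_right)
qed

lemma (in group) group_ring_elem_mult:
  assumes "x \<in> carrier G" "y \<in> carrier G"
  shows "group_ring_elem x \<otimes>\<^bsub>integral_group_ring G\<^esub> group_ring_elem y = group_ring_elem (x \<otimes> y)"
proof
  fix z
  have "{v. group_ring_elem x v \<noteq> 0} = {x}" by (auto simp: group_ring_elem_def)
  moreover have "inv x \<otimes> z = y \<longleftrightarrow> z = x \<otimes> y" if "z \<in> carrier G"
    using assms that by (metis inv_closed inv_solve_left m_closed)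
  moreover have "x \<otimes> y \<in> carrier G" using assms by simp
  ultimately show "(group_ring_elem x \<otimes>\<^bsub>integral_group_ring G\<^esub> group_ring_elem y) z = group_ring_elem (x \<otimes> y) z"
    by (auto simp: integral_group_ring_def group_ring_elem_def)
qed

text \<open>
  Additivity alone forces the values, since every element is a finite integer combination of group
  elements.
\<close>

lemma group_ring_hom_eq_sum:
  assumes fin: "finite (carrier G)" and f: "f \<in> carrier (integral_group_ring G)"
    and \<phi>: "\<phi> \<in> ring_hom (integral_group_ring G) (int_adjoin z)"
  shows "\<phi> f = (\<Sum>x\<in>carrier G. of_int (f x) * \<phi> (group_ring_elem x))"
proof -
  have carr: "h \<in> carrier (integral_group_ring G) \<longleftrightarrow> (\<forall>x. x \<notin> carrier G \<longrightarrow> h x = 0)" for h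
    using fin by (auto simp: integral_group_ring_def intro: finite_subset)
  have add: "\<phi> (\<lambda>x. h x + k x) = \<phi> h + \<phi> k"
    if "\<forall>x. x \<notin> carrier G \<longrightarrow> h x = 0" "\<forall>x. x \<notin> carrier G \<longrightarrow> k x = 0" for h k
    using ring_hom_add [OF \<phi>, of h k] that unfolding carr [symmetric]
    by (simp add: integral_group_ring_def int_adjoin_def)
  have zero: "\<phi> (\<lambda>x. 0) = 0" using add [of "\<lambda>x. 0" "\<lambda>x. 0"] by simp
  have mult: "\<phi> (\<lambda>v. c * group_ring_elem x v) = of_int c * \<phi> (group_ring_elem x)"
    if x: "x \<in> carrier G" for x c
  proof -
    have step: "\<phi> (\<lambda>v. (c + 1) * group_ring_elem x v) =
        \<phi> (\<lambda>v. c * group_ring_elem x v) + \<phi> (group_ring_elem x)" for c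
      using add [of "\<lambda>v. c * group_ring_elem x v" "group_ring_elem x"] x
      by (auto simp: group_ring_elem_def distrib_right)
    show ?thesis
    proof (induction c rule: int_induct [where k = 0])
      case base
      show ?case using zero by simp
    next
      case (step1 i)
      then show ?case using step [of i] by (simp add: distrib_right)
    next
      case (step2 i)
      then show ?case using step [of "i - 1"] by (simp add: left_diff_distrib eq_diff_eq)
    qed
  qed
  have "finite A \<Longrightarrow> A \<subseteq> carrier G \<Longrightarrow>
      \<phi> (\<lambda>v. if v \<in> A then f v else 0) = (\<Sum>x\<in>A. of_int (f x) * \<phi> (group_ring_elem x))" for A
  proof (induction A rule: finite_induct)
    case (insert a A)
    have "(\<lambda>v. if v \<in> insert a A then f v else 0) =
        (\<lambda>v. (if v \<in> A then f v else 0) + f a * group_ring_elem a v)"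
      using insert.hyps by (auto simp: group_ring_elem_def)
    moreover have "\<phi> (\<lambda>v. (if v \<in> A then f v else 0) + f a * group_ring_elem a v) =
        \<phi> (\<lambda>v. if v \<in> A then f v else 0) + \<phi> (\<lambda>v. f a * group_ring_elem a v)"
      using insert.prems by (intro add) (auto simp: group_ring_elem_def)
    ultimately show ?case using insert by (simp add: mult)
  qed (simp add: zero)
  then have "\<phi> (\<lambda>v. if v \<in> carrier G then f v else 0) =
      (\<Sum>x\<in>carrier G. of_int (f x) * \<phi> (group_ring_elem x))" using fin by simp
  moreover have "(\<lambda>v. if v \<in> carrier G then f v else 0) = f" using f unfolding carr by auto
  ultimately show ?thesis by simp
qed

locale cyclic_group_of_order = group G for G (structure) +
  fixes g N
  assumes g: "g \<in> carrier G" and gen: "carrier G = generate G {g}"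
    and N: "Coset.order G = N" "N > 0"
begin

lemma fin: "finite (carrier G)"
  using N card_gt_0_iff [of "carrier G"] by (simp add: Coset.order_def)

lemma ord_g: "ord g = N"
  using generate_pow_card [OF g] N gen by (simp add: Coset.order_def)

definition dlog :: "'a \<Rightarrow> nat"
  where "dlog x = (SOME i. g [^] i = x)"

lemma pow_dlog:
  assumes "x \<in> carrier G"
  shows "g [^] dlog x = x"
proof -
  have "x \<in> {g [^] k | k. k \<in> (UNIV :: nat set)}"
    using generate_pow_nat [OF g] ord_g N gen assms by simp
  then have "\<exists>i::nat. g [^] i = x" by auto
  then show ?thesis unfolding dlog_def by (rule someI_ex)
qed

lemma root_power_cong:
  fixes z :: complex
  assumes z: "z ^ N = 1" and eq: "g [^] (i::nat) = g [^] (j::nat)"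
  shows "z ^ i = z ^ j"
proof -
  have *: "z ^ i = z ^ j" if eq: "g [^] (i::nat) = g [^] (j::nat)" and "i \<le> j" for i j
  proof -
    have "g [^] (j - i) = \<one>" by (rule pow_eq_div2 [OF g eq [symmetric]])
    then obtain k where "j - i = N * k" using pow_eq_id [OF g] ord_g by (auto elim: dvdE)
    then have "j = i + N * k" using that by simp
    then show ?thesis using z by (simp add: power_add power_mult)
  qed
  show ?thesis
  proof (cases "i \<le> j")
    case True
    show ?thesis by (rule * [OF eq True])
  next
    case False
    then show ?thesis using * [OF eq [symmetric]] by simp
  qed
qed

lemma root_power_dlog_mult:
  fixes z :: complex
  assumes "z ^ N = 1" "x \<in> carrier G" "y \<in> carrier G"
  shows "z ^ dlog (x \<otimes> y) = z ^ dlog x * z ^ dlog y"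
proof -
  have "g [^] dlog (x \<otimes> y) = g [^] (dlog x + dlog y)"
    unfolding nat_pow_mult [OF g, symmetric] by (simp only: pow_dlog assms m_closed)
  then have "z ^ dlog (x \<otimes> y) = z ^ (dlog x + dlog y)" by (rule root_power_cong [OF assms(1)])
  then show ?thesis by (simp only: power_add)
qed

text \<open>
  A polynomial representative under the isomorphism with \<open>\<int>[x]/(x\<^sup>N - 1)\<close> that sends \<open>g\<close> to \<open>x\<close>.
  The exponents are arbitrary discrete logarithms, not reduced below \<open>N\<close>: the values at
  \<open>N\<close>-th roots of unity do not depend on the choice.
\<close>

definition rep :: "('a \<Rightarrow> int) \<Rightarrow> int poly"
  where "rep f = (\<Sum>x\<in>carrier G. monom (f x) (dlog x))"

lemma ipoly_rep_mult:
  assumes "z ^ N = 1" "f \<in> carrier (integral_group_ring G)"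
  shows "ipoly (rep (f \<otimes>\<^bsub>integral_group_ring G\<^esub> h)) z = ipoly (rep f) z * ipoly (rep h) z"
  using group_ring_character_mult [OF fin assms(2), of "\<lambda>x. z ^ dlog x" h]
    root_power_dlog_mult [OF assms(1)] by (simp add: rep_def)

lemma ipoly_rep_one:
  assumes "z ^ N = 1"
  shows "ipoly (rep \<one>\<^bsub>integral_group_ring G\<^esub>) z = 1"
proof -
  have "ipoly (rep \<one>\<^bsub>integral_group_ring G\<^esub>) z = (\<Sum>x\<in>carrier G. if x = \<one> then z ^ dlog \<one> else 0)"
    by (auto simp: rep_def integral_group_ring_def group_ring_elem_def intro!: sum.cong)
  also have "\<dots> = z ^ dlog \<one>" using fin by simp
  also have "\<dots> = z ^ 0" by (rule root_power_cong [OF assms]) (simp add: pow_dlog)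
  finally show ?thesis by simp
qed

lemma ring_hom_eq_ipoly_rep:
  assumes z: "z ^ N = 1" and f: "f \<in> carrier (integral_group_ring G)"
    and \<phi>: "\<phi> \<in> ring_hom (integral_group_ring G) (int_adjoin z)" "\<phi> (group_ring_elem g) = z"
  shows "\<phi> f = ipoly (rep f) z"
proof -
  have carr: "group_ring_elem x \<in> carrier (integral_group_ring G)" if "x \<in> carrier G" for x
  proof -
    have "{v. group_ring_elem x v \<noteq> 0} = {x}" by (auto simp: group_ring_elem_def)
    then show ?thesis using that by (simp add: integral_group_ring_def)
  qed
  have pow: "\<phi> (group_ring_elem (g [^] i)) = z ^ i" for i :: nat
  proof (induction i)
    case 0
    have "\<phi> \<one>\<^bsub>integral_group_ring G\<^esub> = \<one>\<^bsub>int_adjoin z\<^esub>" using \<phi>(1) by (rule ring_hom_one)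
    then show ?case by (simp add: integral_group_ring_def int_adjoin_def)
  next
    case (Suc i)
    have "\<phi> (group_ring_elem (g [^] i) \<otimes>\<^bsub>integral_group_ring G\<^esub> group_ring_elem g) =
        \<phi> (group_ring_elem (g [^] i)) \<otimes>\<^bsub>int_adjoin z\<^esub> \<phi> (group_ring_elem g)"
      using g by (intro ring_hom_mult [OF \<phi>(1)] carr) auto
    then show ?case
      using Suc \<phi>(2) g by (simp add: group_ring_elem_mult) (simp add: int_adjoin_def)
  qed
  have "\<phi> f = (\<Sum>x\<in>carrier G. of_int (f x) * \<phi> (group_ring_elem x))"
    by (rule group_ring_hom_eq_sum [OF fin f \<phi>(1)])
  also have "\<dots> = (\<Sum>x\<in>carrier G. of_int (f x) * z ^ dlog x)"
    using pow [of "dlog _"] pow_dlog by (intro sum.cong refl) metis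
  finally show ?thesis by (simp add: rep_def)
qed

end

section \<open>The congruence obstruction\<close>

text \<open>
  The root \<open>1\<close> contributes \<open>t\<close>. At the other roots the factor is \<open>(1 - w ^ t) / (1 - w)\<close>, and
  these cancel because \<open>w \<mapsto> w ^ t\<close> permutes them.
\<close>

lemma prod_geometric_sums_at_roots:
  assumes z: "has_order z q" and t: "coprime t q"
  shows "(\<Prod>w::complex | w ^ q = 1. \<Sum>i<t. w ^ i) = of_nat t"
proof -
  let ?A = "{w::complex. w ^ q = 1}" let ?B = "?A - {1}"
  have fin: "finite ?A" using finite_roots [OF z] .
  obtain x where x: "[t * x = Suc 0] (mod q)" using cong_solve_coprime_nat [OF t] by blast
  have tx: "w ^ (t * x) = w" if w: "w ^ q = 1" for w :: complex
  proof -
    obtain i where i: "w = z ^ i" using root_of_unity_is_power [OF z w] by blast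
    have "[i * (t * x) = i * Suc 0] (mod q)" using x by (rule cong_scalar_left)
    then have "i * (t * x) mod q = i mod q" unfolding cong_def by (simp only: mult_Suc_right mult_0_right add_0_right)
    then show ?thesis
      unfolding i power_mult [symmetric] has_order_power_eq_iff [OF z] .
  qed
  have bij: "bij_betw (\<lambda>w. w ^ t) ?B ?B"
  proof (rule bij_betw_byWitness [where f' = "\<lambda>w. w ^ x"])
    show "\<forall>w\<in>?B. (w ^ t) ^ x = w" by (simp add: tx flip: power_mult)
    show "\<forall>w\<in>?B. (w ^ x) ^ t = w" by (simp add: tx mult.commute [of x] flip: power_mult)
    have pow: "(w ^ k) ^ q = 1" if "w ^ q = 1" for w :: complex and k
      using that by (metis mult.commute power_mult power_one)
    have "w ^ t \<noteq> 1" "w ^ x \<noteq> 1" if "w ^ q = 1" "w \<noteq> 1" for w :: complex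
      using tx [OF that(1)] that(2) by (metis mult.commute power_mult power_one)+
    then show "(\<lambda>w. w ^ t) ` ?B \<subseteq> ?B" "(\<lambda>w. w ^ x) ` ?B \<subseteq> ?B"
      using pow by auto
  qed
  have "(\<Prod>w\<in>?B. 1 - w) \<noteq> 0" using fin by simp
  moreover have "(\<Prod>w\<in>?B. 1 - w) * (\<Prod>w\<in>?B. \<Sum>i<t. w ^ i) = (\<Prod>w\<in>?B. 1 - w ^ t)"
    by (simp add: one_diff_power_eq prod.distrib)
  moreover have "(\<Prod>w\<in>?B. 1 - w ^ t) = (\<Prod>w\<in>?B. 1 - w)"
    by (rule prod.reindex_bij_betw [OF bij])
  ultimately have "(\<Prod>w\<in>?B. \<Sum>i<t. w ^ i) = 1" by simp
  moreover have "(\<Prod>w\<in>?A. \<Sum>i<t. w ^ i) = (\<Sum>i<t. 1 ^ i) * (\<Prod>w\<in>?B. \<Sum>i<t. w ^ i)"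
    using fin by (intro prod.remove) auto
  ultimately show ?thesis by simp
qed

lemma prod_roots_of_unity_inverse:
  assumes z: "has_order z q" and inv: "\<And>w. w ^ q = 1 \<Longrightarrow> ipoly P w * ipoly Q w = 1"
  shows "\<exists>d::int. (d = 1 \<or> d = -1) \<and> (\<Prod>w | w ^ q = 1. ipoly Q w) = of_int d"
proof -
  obtain c d :: int where c: "(\<Prod>w | w ^ q = 1. ipoly P w) = of_int c"
    and d: "(\<Prod>w | w ^ q = 1. ipoly Q w) = of_int d"
    using prod_roots_of_unity_Ints [OF z] by (metis Ints_cases)
  have "(of_int c * of_int d :: complex) = (\<Prod>w::complex | w ^ q = 1. 1)"
    unfolding c [symmetric] d [symmetric] prod.distrib [symmetric] by (rule prod.cong) (auto simp: inv)
  then have "of_int (c * d) = (of_int 1 :: complex)" by simp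
  then have "c * d = 1" by (simp only: of_int_eq_iff)
  then have "d = 1 \<or> d = -1" by (auto simp: zmult_eq_1_iff)
  then show ?thesis using d by blast
qed

text \<open>
  Let \<open>u\<close> be a unit mapped to \<open>\<plusminus>\<mu>\<^sub>t ^ e\<close>, let \<open>U\<close> and \<open>V\<close> represent \<open>u\<close> and its inverse, and let
  \<open>F\<close> be \<open>\<plusminus>(1 + x + \<dots> + x^(t - 1)) ^ e\<close>. Since \<open>U - F\<close> vanishes at \<open>z\<close>, it is a multiple of the
  cyclotomic polynomial, which takes the value \<open>p\<close> at each \<open>p ^ k\<close>-th root of unity. At those roots
  \<open>F * V = U * V + p * (\<dots>) = 1 + p * (\<dots>)\<close>, so the product of all these values is \<open>1\<close> modulo
  \<open>p ^ (k + 1)\<close>. On the other hand the values of \<open>V\<close> multiply to \<open>\<plusminus>1\<close> and those of \<open>F\<close> to \<open>\<plusminus>t ^ e\<close>.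
\<close>

theorem (in cyclic_group_of_order) geometric_sum_power_in_image_imp_cong:
  fixes z :: complex and \<epsilon> :: int
  assumes p: "prime p" and N_eq: "N = p ^ Suc k" and z: "has_order z N"
    and \<phi>: "\<phi> \<in> ring_hom (integral_group_ring G) (int_adjoin z)" "\<phi> (group_ring_elem g) = z"
    and t: "coprime t p" and \<epsilon>: "\<epsilon> = 1 \<or> \<epsilon> = -1"
    and img: "of_int \<epsilon> * (\<Sum>i<t. z ^ i) ^ e \<in> \<phi> ` Units (integral_group_ring G)"
  shows "[int t ^ e = 1] (mod int (p ^ Suc k)) \<or> [int t ^ e = -1] (mod int (p ^ Suc k))"
proof -
  let ?R = "integral_group_ring G" and ?q = "p ^ k"
  define F where "F = smult \<epsilon> ((\<Sum>i<t. monom 1 i) ^ e)"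
  have zN: "z ^ N = 1" using z by (simp add: has_order_def)
  have zq: "has_order (z ^ p) ?q" using z unfolding N_eq power_Suc by (rule has_order_power)
  obtain u where u: "u \<in> Units ?R" "\<phi> u = of_int \<epsilon> * (\<Sum>i<t. z ^ i) ^ e"
    using img by auto
  then obtain v where v: "v \<in> carrier ?R" "v \<otimes>\<^bsub>?R\<^esub> u = \<one>\<^bsub>?R\<^esub>" "u \<in> carrier ?R"
    by (auto simp: Units_def)
  define U where "U = rep u"
  define V where "V = rep v"
  have VU: "ipoly V w * ipoly U w = 1" if w: "w ^ ?q = 1" for w
  proof -
    have "w ^ N = 1" using w unfolding N_eq by (metis mult.commute power_Suc power_mult power_one)
    then show ?thesis
      using ipoly_rep_mult [of w v u] ipoly_rep_one [of w] v by (simp add: U_def V_def)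
  qed
  have "ipoly (U - F) z = 0"
    using ring_hom_eq_ipoly_rep [OF zN v(3) \<phi>] u(2) by (simp add: U_def F_def)
  then obtain R where R: "U - F = cyclo p ?q * R"
    using cyclo_dvd_if_vanishing [OF p] z unfolding N_eq by (metis dvdE)
  have FV: "ipoly F w * ipoly V w = 1 + of_nat p * ipoly (- (R * V)) w" if w: "w ^ ?q = 1" for w
  proof -
    have "ipoly (U - F) w = of_nat p * ipoly R w" by (simp only: R ipoly_mult ipoly_cyclo_1 [OF w])
    then have "ipoly F w * ipoly V w = ipoly V w * ipoly U w - of_nat p * (ipoly R w * ipoly V w)"
      by (simp add: algebra_simps)
    then show ?thesis by (simp add: VU [OF w])
  qed
  obtain c where c: "(\<Prod>w | w ^ ?q = 1. 1 + of_nat p * ipoly (- (R * V)) w) = of_int (1 + int p ^ Suc k * c)"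
    using prod_roots_of_unity_cong_1 [OF p zq] by blast
  obtain d where d: "d = 1 \<or> d = -1" "(\<Prod>w | w ^ ?q = 1. ipoly V w) = of_int d"
    using prod_roots_of_unity_inverse [OF zq, of U V] VU by (auto simp: mult.commute)
  have "coprime t ?q" using t by simp
  then have "(\<Prod>w | w ^ ?q = 1. ipoly F w) = of_int \<epsilon> ^ ?q * of_nat t ^ e"
    using prod_geometric_sums_at_roots [OF zq]
    by (simp add: F_def prod.distrib card_roots [OF zq] flip: prod_power_distrib)
  then have "of_int (\<epsilon> ^ ?q * int t ^ e * d) = (\<Prod>w | w ^ ?q = 1. ipoly F w) * (\<Prod>w | w ^ ?q = 1. ipoly V w)"
    using d by simp
  also have "\<dots> = (\<Prod>w | w ^ ?q = 1. 1 + of_nat p * ipoly (- (R * V)) w)"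
    unfolding prod.distrib [symmetric] by (rule prod.cong) (auto simp only: FV mem_Collect_eq)
  also have "\<dots> = of_int (1 + int p ^ Suc k * c)" by (rule c)
  finally have "(\<epsilon> ^ ?q * d) * int t ^ e = 1 + int p ^ Suc k * c"
    by (simp only: of_int_eq_iff mult_ac)
  then have cong: "[(\<epsilon> ^ ?q * d) * int t ^ e = 1] (mod int (p ^ Suc k))"
    by (simp add: cong_iff_dvd_diff)
  have "\<epsilon> ^ ?q = 1 \<or> \<epsilon> ^ ?q = -1" using \<epsilon> by (cases "even ?q") auto
  then consider "\<epsilon> ^ ?q * d = 1" | "\<epsilon> ^ ?q * d = -1" using d(1) by auto
  then show ?thesis
  proof cases
    case 1
    then show ?thesis using cong by simp
  next
    case 2
    then have "[- (int t ^ e) = 1] (mod int (p ^ Suc k))" using cong by simp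
    then have "[int t ^ e = - 1] (mod int (p ^ Suc k))"
      using cong_minus_minus_iff [of "- (int t ^ e)" 1] by simp
    then show ?thesis ..
  qed
qed

text \<open>
  Squaring \<open>1 + 2 ^ (k + 3) * (odd)\<close> raises the exponent of \<open>2\<close> by exactly one, starting from
  \<open>9 = 1 + 8\<close>.
\<close>

lemma three_power_two_power:
  "\<exists>c. (3::int) ^ 2 ^ Suc k = 1 + 2 ^ (k + 3) + 2 ^ (k + 4) * c"
proof (induction k)
  case 0
  show ?case by (intro exI [of _ 0]) simp
next
  case (Suc k)
  then obtain c where c: "(3::int) ^ 2 ^ Suc k = 1 + 2 ^ (k + 3) + 2 ^ (k + 4) * c" by blast
  define x where "x = (2::int) ^ k"
  have "(3::int) ^ 2 ^ Suc (Suc k) = (3 ^ 2 ^ Suc k)\<^sup>2"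
    by (simp only: power_Suc [of 2 "Suc k"] power_mult [symmetric] mult.commute)
  also have "\<dots> = (1 + 8 * x + 16 * x * c)\<^sup>2" unfolding c x_def by (simp add: power_add mult.commute)
  also have "\<dots> = 1 + 16 * x + 32 * x * (c + 2 * x * (1 + 2 * c)\<^sup>2)"
    by (simp add: power2_eq_square algebra_simps)
  finally show ?case by (auto simp: x_def power_add)
qed

text \<open>
  For \<open>n \<ge> 4\<close> the power is \<open>1 + 2 ^ (n - 1)\<close> modulo \<open>2 ^ n\<close>; for \<open>n = 3\<close> it is \<open>3\<close> modulo \<open>8\<close>.
\<close>

lemma three_power_not_cong:
  assumes n: "n \<ge> 3"
  shows "\<not> [(3::int) ^ 2 ^ (n - 3) = 1] (mod 2 ^ n)" "\<not> [(3::int) ^ 2 ^ (n - 3) = -1] (mod 2 ^ n)"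
proof -
  have "\<not> [(3::int) ^ 2 ^ (n - 3) = 1] (mod 2 ^ n) \<and> \<not> [(3::int) ^ 2 ^ (n - 3) = -1] (mod 2 ^ n)"
  proof (cases "n = 3")
    case True
    then show ?thesis by (simp add: cong_def)
  next
    case False
    define k where "k = n - 4"
    have k: "n = k + 4" "n - 3 = Suc k" using n False by (auto simp: k_def)
    define x where "x = (2::int) ^ k"
    have x: "x > 0" "2 ^ n = 16 * x" by (auto simp: x_def k power_add)
    obtain c where "(3::int) ^ 2 ^ (n - 3) = 1 + 8 * x + 16 * x * c"
      using three_power_two_power [of k] by (auto simp: k x_def power_add)
    moreover have "\<not> 16 * x dvd (1 + 8 * x + 16 * x * c) - 1"
    proof
      assume "16 * x dvd (1 + 8 * x + 16 * x * c) - 1"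
      then obtain d where "x * (8 + 16 * c) = x * (16 * d)" by (auto elim!: dvdE simp: algebra_simps)
      then have "8 + 16 * c = 16 * d" using x by simp
      then show False by presburger
    qed
    moreover have "\<not> 16 * x dvd (1 + 8 * x + 16 * x * c) - (-1)"
    proof
      assume "16 * x dvd (1 + 8 * x + 16 * x * c) - (-1)"
      then obtain d where "1 + 8 * x + 16 * x * c + 1 = 16 * x * d" by (auto elim!: dvdE)
      then have "2 = 4 * (4 * (x * d) - 2 * x - 4 * (x * c))" by (simp add: algebra_simps)
      then show False by presburger
    qed
    ultimately show ?thesis by (simp add: cong_iff_dvd_diff x)
  qed
  then show "\<not> [(3::int) ^ 2 ^ (n - 3) = 1] (mod 2 ^ n)" "\<not> [(3::int) ^ 2 ^ (n - 3) = -1] (mod 2 ^ n)"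
    by auto
qed

lemma
  assumes N: "N > 1"
    and gen: "Units (residue_ring (int N)) =
      generate (units_of (residue_ring (int N))) {int t mod int N}"
  shows generator_coprime: "coprime t N"
    and totient_dvd_if_generator_power: "[int t ^ e = 1] (mod int N) \<Longrightarrow> totient N dvd e"
proof -
  let ?R = "residue_ring (int N)"
  interpret residues "int N" ?R using N by unfold_locales simp_all
  let ?a = "int t mod int N"
  have a: "?a \<in> Units ?R" unfolding gen by (rule generate.incl) simp
  then have "coprime ?a (int N)" by (simp add: res_units_eq)
  then show "coprime t N" using N by (simp flip: zmod_int)
  interpret U: group "units_of ?R" by (rule units_group)
  have aU: "?a \<in> carrier (units_of ?R)" using a by (simp add: units_of_carrier)
  have "U.ord ?a = totient N"
    using U.generate_pow_card [OF aU] totient_eq gen by simp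
  moreover assume "[int t ^ e = 1] (mod int N)"
  then have "?a [^]\<^bsub>units_of ?R\<^esub> e = \<one>\<^bsub>units_of ?R\<^esub>"
    using a N by (simp add: units_of_pow units_of_one pow_cong one_cong cong_def)
  ultimately show "totient N dvd e" using U.pow_eq_id [OF aU] by simp
qed

theorem proposition12:
  fixes p n t :: nat and \<theta> :: complex
    and G :: "('g, 'm) monoid_scheme" and g :: 'g and \<pi>\<^sub>1 :: "('g \<Rightarrow> int) \<Rightarrow> complex"
  assumes "prime p" and "n \<ge> 2" and "p = 2 \<Longrightarrow> n \<ge> 3"
    and "totient (p ^ n) \<le> 66"
    and "\<theta> ^ (p ^ n) = 1" and "\<forall>k\<in>{0<..<p ^ n}. \<theta> ^ k \<noteq> 1"
    and "group G" and "Coset.order G = p ^ n" and "g \<in> carrier G" and "carrier G = generate G {g}"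
    and "\<pi>\<^sub>1 \<in> ring_hom (integral_group_ring G) (int_adjoin \<theta>)"
    and "\<pi>\<^sub>1 (group_ring_elem g) = \<theta>"
    and "t > 0"
    and "odd p \<Longrightarrow> Units (residue_ring (int (p ^ n))) =
      generate (units_of (residue_ring (int (p ^ n)))) {int t mod int (p ^ n)}"
    and "p = 2 \<Longrightarrow> t = 3"
  shows "(-1) ^ p * (\<Sum>i<t. \<theta> ^ i) ^ (totient (p ^ n) div (2 * p))
    \<notin> \<pi>\<^sub>1 ` units_of_augmentation_one G"
proof
  define e where "e = totient (p ^ n) div (2 * p)"
  assume "(-1) ^ p * (\<Sum>i<t. \<theta> ^ i) ^ (totient (p ^ n) div (2 * p))
    \<in> \<pi>\<^sub>1 ` units_of_augmentation_one G"
  then have img: "of_int ((-1) ^ p) * (\<Sum>i<t. \<theta> ^ i) ^ e \<in> \<pi>\<^sub>1 ` Units (integral_group_ring G)"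
    by (auto simp: e_def units_of_augmentation_one_def)
  obtain k where n: "n = Suc k" using assms(2) by (cases n) auto
  have p1: "p > 1" using prime_gt_1_nat [OF assms(1)] .
  then have N1: "p ^ n > 1" using one_less_power [of p n] n by simp
  have z: "has_order \<theta> (p ^ n)" using assms(5,6) N1 p1 by (simp add: has_order_def)
  interpret G: cyclic_group_of_order G g "p ^ n"
    by (intro cyclic_group_of_order.intro cyclic_group_of_order_axioms.intro)
      (use assms(7-10) p1 in auto)
  have sign: "(-1) ^ p = (1::int) \<or> (-1) ^ p = (-1::int)" by (cases "even p") auto
  have tot: "totient (p ^ n) = p ^ k * (p - 1)"
    using totient_prime_power_Suc [OF assms(1)] by (simp add: n)
  have cong: "[int t ^ e = 1] (mod int (p ^ n)) \<or> [int t ^ e = -1] (mod int (p ^ n))" if "coprime t p"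
    unfolding n
    by (rule G.geometric_sum_power_in_image_imp_cong
          [OF assms(1) arg_cong [where f = "\<lambda>i. p ^ i", OF n] z assms(11,12) that sign img])
  show False
  proof (cases "p = 2")
    case True
    then have "n \<ge> 3" "t = 3" using assms(3,15) by auto
    then have "e = 2 ^ (n - 3)"
      using True tot n by (simp add: e_def power_diff)
    moreover have "coprime t p" using True \<open>t = 3\<close> by simp
    ultimately show False
      using cong three_power_not_cong [OF \<open>n \<ge> 3\<close>] True \<open>t = 3\<close> by simp
  next
    case False
    then have p3: "p \<ge> 3" "odd p" using p1 assms(1) prime_odd_nat [of p] by auto
    note gen = assms(14) [OF p3(2)]
    have "coprime t (p ^ n)" using generator_coprime [OF N1 gen] .
    then have "coprime t p" using n by simp
    \<comment> \<open>Squaring removes the sign, and the exponent \<open>2 * e = totient (p ^ n) div p\<close> is still too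
      small for a generator.\<close>
    then have "[(int t ^ e) ^ 2 = 1] (mod int (p ^ n))"
      using cong by (auto dest: cong_pow [where n = 2])
    then have "totient (p ^ n) dvd e * 2"
      by (intro totient_dvd_if_generator_power [OF N1 gen]) (simp add: power_mult)
    moreover have "e > 0"
    proof -
      have "p ^ 1 \<le> p ^ k" using p1 assms(2) n by (intro power_increasing) auto
      then have "p * 2 \<le> p ^ k * (p - 1)" using p3 by (intro mult_mono) auto
      then show ?thesis using p1 by (simp add: e_def tot div_greater_zero_iff mult.commute)
    qed
    ultimately have "totient (p ^ n) \<le> e * 2" by (intro dvd_imp_le) auto
    moreover have "e * (2 * p) \<le> totient (p ^ n)" by (simp add: e_def)
    moreover have "e * 2 * 3 \<le> e * 2 * p" using p3 by (intro mult_le_mono) auto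
    ultimately show False using \<open>e > 0\<close> by linarith
  qed
qed

end
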